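(* Let $(\mathcal{X},p(y_1,y_2|x),\mathcal{Y}_1\times\mathcal{Y}_2)$ be any discrete memoryless broadcast channel, with cooperating receivers having noiseless conference links of finite capacities $C_{12}$ (from receiver 1 to receiver 2) and $C_{21}$ (from receiver 2 to receiver 1). Then, for sending a common message to both receivers, any rate $R$ satisfying $$R\le\sup_{p(x)}\Big[\max\big\{R^{12}(p(x)),\,R^{21}(p(x))\big\}\Big],$$ $$R^{12}(p(x))\triangleq\min\Big(I(X;Y_1)+C_{21},\; I(X;Y_2)-H(Y_1|Y_2,X)+\min\big(C_{12},\,H(Y_1|Y_2)\big)\Big),$$ $$R^{21}(p(x))\triangleq\min\Big(I(X;Y_2)+C_{12},\; I(X;Y_1)-H(Y_2|Y_1,X)+\min\big(C_{21},\,H(Y_2|Y_1)\big)\Big),$$ with the appropriate $C_{12}>H(Y_1|Y_2,X)$ (for $R^{12}$) or $C_{21}>H(Y_2|Y_1,X)$ (for $R^{21}$), namely the condition on the link used for the first cooperation step, is achievable. (All information quantities are computed under $p(x)p(y_1,y_2|x)$, and $R^{12}(p(x))$, respectively $R^{21}(p(x))$, enters the maximum only for those $p(x)$ for which its condition holds.)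
   Context: All alphabets are finite, and entropies and mutual informations are in bits. Rates and link capacities are nonnegative reals. A discrete memoryless broadcast channel with input alphabet $\mathcal{X}$, output alphabets $\mathcal{Y}_1,\mathcal{Y}_2$ and transition function $p(y_1,y_2|x)$ satisfies $p(y_1^n,y_2^n|x^n)=\prod_{i=1}^n p(y_{1,i},y_{2,i}|x_i)$; receiver $k$ observes $Y_k^n$. Conference: after reception each receiver sends at most one message to the other. The conference message sets are $\mathcal{W}_{12}=\{1,\dots,2^{nR_{12}}\}$ and $\mathcal{W}_{21}=\{1,\dots,2^{nR_{21}}\}$ with $R_{12}\le C_{12}$, $R_{21}\le C_{21}$. The message $W_{12}\in\mathcal{W}_{12}$ sent by receiver 1 is a function of $Y_1^n$ and of any message already received from receiver 2, and $W_{21}\in\mathcal{W}_{21}$ sent by receiver 2 is a function of $Y_2^n$ and of any message already received from receiver 1; i.e. either $W_{12}=h_{12}(Y_1^n)$ and $W_{21}=h_{21}(Y_2^n,W_{12})$, or $W_{21}=h_{21}(Y_2^n)$ and $W_{12}=h_{12}(Y_1^n,W_{21})$. The rates $R^{12}$ and $R^{21}$ correspond to a two-step conference in which the first cooperation step is from receiver 1 to receiver 2, respectively from receiver 2 to receiver 1. A code of block length $n$ and rate $R$ for a common message consists of a message set $\mathcal{W}=\{1,2,\dots,2^{nR}\}$, an encoder $f:\mathcal{W}\to\mathcal{X}^n$, a conference as just described, and decoders $g_1:\mathcal{W}_{21}\times\mathcal{Y}_1^n\to\mathcal{W}$, $g_2:\mathcal{W}_{12}\times\mathcal{Y}_2^n\to\mathcal{W}$.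 The message $W$ is uniform on $\mathcal{W}$, $X^n=f(W)$ is sent, and $P_e^{(n)}=\Pr(g_1(W_{21},Y_1^n)\ne W\text{ or }g_2(W_{12},Y_2^n)\ne W)$. A rate $R$ is achievable if there exists a sequence of codes of rate $R$ with $P_e^{(n)}\to0$ as $n\to\infty$.
   Formalization: At R equal to the supremum, "achievable" means codes whose rates tend to R with vanishing error (exactly 2^{nR} messages can fail there, e.g. a BSC at capacity); codes of rate exactly R are claimed for R strictly below the supremum. Message-set sizes are rounded down to integers. *)

theory Defs
  imports "HOL-Probability.Probability"
begin

section \<open>Codes for a broadcast channel with conferencing receivers\<close>

text \<open>
  A broadcast channel with input alphabet \<open>'x\<close> and output alphabets \<open>'y\<close> (receiver 1) and \<open>'z\<close>
  (receiver 2) is a kernel \<open>'x \<Rightarrow> ('y \<times> 'z) pmf\<close>.  A block of length \<open>n\<close> is a function on \<open>nat\<close>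
  whose coordinates \<open>i < n\<close> are the symbols.  The outputs of \<open>dmc\<close> are constant outside \<open>{..<n}\<close>
  (the convention of \<open>Pi_pmf\<close>), and \<open>dmc\<close> ignores the coordinates of its input outside \<open>{..<n}\<close>,
  so the remaining coordinates carry no information.
\<close>

definition dmc :: "('x \<Rightarrow> ('y \<times> 'z) pmf) \<Rightarrow> nat \<Rightarrow> (nat \<Rightarrow> 'x) \<Rightarrow> (nat \<Rightarrow> 'y \<times> 'z) pmf" where
  "dmc Q n xs = Pi_pmf {..<n} undefined (\<lambda>i. Q (xs i))"

definition message_set :: "nat \<Rightarrow> real \<Rightarrow> nat set" where
  "message_set n r = {1..nat \<lfloor>2 powr (real n * r)\<rfloor>}"

text \<open>
  \<open>First1 h12 h21\<close>: receiver 1 sends \<open>h12 ys\<close>, and receiver 2 answers with \<open>h21 zs w12\<close>.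
  \<open>First2 h21 h12\<close>: receiver 2 sends \<open>h21 zs\<close>, and receiver 1 answers with \<open>h12 ys w21\<close>.
\<close>

datatype ('y, 'z) conference =
    First1 "(nat \<Rightarrow> 'y) \<Rightarrow> nat" "(nat \<Rightarrow> 'z) \<Rightarrow> nat \<Rightarrow> nat"
  | First2 "(nat \<Rightarrow> 'z) \<Rightarrow> nat" "(nat \<Rightarrow> 'y) \<Rightarrow> nat \<Rightarrow> nat"

text \<open>The pair \<open>(W12, W21)\<close> of exchanged messages.\<close>

fun conf_messages :: "('y, 'z) conference \<Rightarrow> (nat \<Rightarrow> 'y) \<Rightarrow> (nat \<Rightarrow> 'z) \<Rightarrow> nat \<times> nat" where
  "conf_messages (First1 h12 h21) ys zs = (h12 ys, h21 zs (h12 ys))"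
| "conf_messages (First2 h21 h12) ys zs = (h12 ys (h21 zs), h21 zs)"

fun is_conference :: "nat \<Rightarrow> real \<Rightarrow> real \<Rightarrow> ('y, 'z) conference \<Rightarrow> bool" where
  "is_conference n R12 R21 (First1 h12 h21) \<longleftrightarrow>
     h12 \<in> UNIV \<rightarrow> message_set n R12 \<and>
     h21 \<in> UNIV \<rightarrow> message_set n R12 \<rightarrow> message_set n R21"
| "is_conference n R12 R21 (First2 h21 h12) \<longleftrightarrow>
     h21 \<in> UNIV \<rightarrow> message_set n R21 \<and>
     h12 \<in> UNIV \<rightarrow> message_set n R21 \<rightarrow> message_set n R12"

record ('x, 'y, 'z) bc_code =
  encoder :: "nat \<Rightarrow> nat \<Rightarrow> 'x"
  conf :: "('y, 'z) conference"
  decoder1 :: "nat \<Rightarrow> (nat \<Rightarrow> 'y) \<Rightarrow> nat"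
  decoder2 :: "nat \<Rightarrow> (nat \<Rightarrow> 'z) \<Rightarrow> nat"

definition is_code :: "nat \<Rightarrow> real \<Rightarrow> real \<Rightarrow> real \<Rightarrow> ('x, 'y, 'z) bc_code \<Rightarrow> bool" where
  "is_code n r R12 R21 c \<longleftrightarrow>
     is_conference n R12 R21 (conf c) \<and>
     decoder1 c \<in> message_set n R21 \<rightarrow> UNIV \<rightarrow> message_set n r \<and>
     decoder2 c \<in> message_set n R12 \<rightarrow> UNIV \<rightarrow> message_set n r"

definition decoding_error :: "('x, 'y, 'z) bc_code \<Rightarrow> nat \<Rightarrow> (nat \<Rightarrow> 'y) \<Rightarrow> (nat \<Rightarrow> 'z) \<Rightarrow> bool" where
  "decoding_error c w ys zs \<longleftrightarrow>
     (case conf_messages (conf c) ys zs of (w12, w21) \<Rightarrow>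
        decoder1 c w21 ys \<noteq> w \<or> decoder2 c w12 zs \<noteq> w)"

text \<open>The message \<open>w\<close> is uniform; \<open>out i\<close> is the pair of symbols received at time \<open>i\<close>.\<close>

definition error_prob :: "('x \<Rightarrow> ('y \<times> 'z) pmf) \<Rightarrow> nat \<Rightarrow> real \<Rightarrow> ('x, 'y, 'z) bc_code \<Rightarrow> real" where
  "error_prob Q n r c =
     measure_pmf.prob
       (bind_pmf (pmf_of_set (message_set n r)) (\<lambda>w.
          map_pmf (\<lambda>out. (w, out)) (dmc Q n (encoder c w))))
       {(w, out). decoding_error c w (fst \<circ> out) (snd \<circ> out)}"

text \<open>\<open>r n\<close> is the rate of the code of block length \<open>n\<close>.\<close>

definition achievable_rates ::
    "('x \<Rightarrow> ('y \<times> 'z) pmf) \<Rightarrow> real \<Rightarrow> real \<Rightarrow> (nat \<Rightarrow> real) \<Rightarrow> bool" where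
  "achievable_rates Q C12 C21 r \<longleftrightarrow>
     (\<exists>R12\<in>{0..C12}. \<exists>R21\<in>{0..C21}. \<exists>c :: nat \<Rightarrow> ('x, 'y, 'z) bc_code.
        (\<forall>n. is_code n (r n) R12 R21 (c n)) \<and>
        (\<lambda>n. error_prob Q n (r n) (c n)) \<longlonglongrightarrow> 0)"

text \<open>
  Two readings of ``there is a sequence of codes of rate \<open>R\<close> with vanishing error probability''.
  In \<open>achievable_exactly\<close> every code has rate \<open>R\<close>, that is, \<open>\<lfloor>2 powr (n * R)\<rfloor>\<close> messages; in
  \<open>achievable\<close> the rates of the codes tend to \<open>R\<close>.  They differ only at the boundary:
  with exactly \<open>\<lfloor>2 powr (n * C)\<rfloor>\<close> messages the error probability of a channel of capacity \<open>C\<close>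
  need not vanish (for a binary symmetric channel it does not).
\<close>

definition achievable_exactly :: "('x \<Rightarrow> ('y \<times> 'z) pmf) \<Rightarrow> real \<Rightarrow> real \<Rightarrow> real \<Rightarrow> bool" where
  "achievable_exactly Q C12 C21 R \<longleftrightarrow> achievable_rates Q C12 C21 (\<lambda>_. R)"

definition achievable :: "('x \<Rightarrow> ('y \<times> 'z) pmf) \<Rightarrow> real \<Rightarrow> real \<Rightarrow> real \<Rightarrow> bool" where
  "achievable Q C12 C21 R \<longleftrightarrow>
     (\<exists>r. (\<forall>n. 0 \<le> r n) \<and> r \<longlonglongrightarrow> R \<and> achievable_rates Q C12 C21 r)"


section \<open>The rate expressions\<close>

definition mutual_info :: "'a pmf \<Rightarrow> ('a \<Rightarrow> 'b) \<Rightarrow> ('a \<Rightarrow> 'c) \<Rightarrow> real" where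
  "mutual_info P U V =
     prob_space.mutual_information (measure_pmf P) 2 (count_space UNIV) (count_space UNIV) U V"

text \<open>\<open>cond_entropy P U V\<close> is \<open>H(U | V)\<close>.\<close>

definition cond_entropy :: "'a pmf \<Rightarrow> ('a \<Rightarrow> 'b) \<Rightarrow> ('a \<Rightarrow> 'c) \<Rightarrow> real" where
  "cond_entropy P U V =
     prob_space.conditional_entropy (measure_pmf P) 2 (count_space UNIV) (count_space UNIV) U V"

text \<open>The joint distribution of \<open>(X, Y1, Y2)\<close>.\<close>

definition joint :: "('x \<Rightarrow> ('y \<times> 'z) pmf) \<Rightarrow> 'x pmf \<Rightarrow> ('x \<times> 'y \<times> 'z) pmf" where
  "joint Q p = bind_pmf p (\<lambda>x. map_pmf (\<lambda>yz. (x, yz)) (Q x))"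

definition inX :: "'x \<times> 'y \<times> 'z \<Rightarrow> 'x" where "inX = (\<lambda>(x, y, z). x)"
definition outY1 :: "'x \<times> 'y \<times> 'z \<Rightarrow> 'y" where "outY1 = (\<lambda>(x, y, z). y)"
definition outY2 :: "'x \<times> 'y \<times> 'z \<Rightarrow> 'z" where "outY2 = (\<lambda>(x, y, z). z)"

definition rate12 :: "('x \<Rightarrow> ('y \<times> 'z) pmf) \<Rightarrow> real \<Rightarrow> real \<Rightarrow> 'x pmf \<Rightarrow> real" where
  "rate12 Q C12 C21 p = (let P = joint Q p in
     min (mutual_info P inX outY1 + C21)
         (mutual_info P inX outY2 - cond_entropy P outY1 (\<lambda>\<omega>. (outY2 \<omega>, inX \<omega>))
            + min C12 (cond_entropy P outY1 outY2)))"

definition rate21 :: "('x \<Rightarrow> ('y \<times> 'z) pmf) \<Rightarrow> real \<Rightarrow> real \<Rightarrow> 'x pmf \<Rightarrow> real" where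
  "rate21 Q C12 C21 p = (let P = joint Q p in
     min (mutual_info P inX outY2 + C12)
         (mutual_info P inX outY1 - cond_entropy P outY2 (\<lambda>\<omega>. (outY1 \<omega>, inX \<omega>))
            + min C21 (cond_entropy P outY2 outY1)))"

definition admissible12 :: "('x \<Rightarrow> ('y \<times> 'z) pmf) \<Rightarrow> real \<Rightarrow> 'x pmf \<Rightarrow> bool" where
  "admissible12 Q C12 p \<longleftrightarrow> C12 > cond_entropy (joint Q p) outY1 (\<lambda>\<omega>. (outY2 \<omega>, inX \<omega>))"

definition admissible21 :: "('x \<Rightarrow> ('y \<times> 'z) pmf) \<Rightarrow> real \<Rightarrow> 'x pmf \<Rightarrow> bool" where
  "admissible21 Q C21 p \<longleftrightarrow> C21 > cond_entropy (joint Q p) outY2 (\<lambda>\<omega>. (outY1 \<omega>, inX \<omega>))"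

text \<open>
  A rate whose admissibility condition fails is replaced by \<open>-\<infinity>\<close>, so that it does not
  enter the maximum; the supremum is \<open>-\<infinity>\<close> if no input distribution is admissible.
\<close>

definition rate_bound :: "('x \<Rightarrow> ('y \<times> 'z) pmf) \<Rightarrow> real \<Rightarrow> real \<Rightarrow> ereal" where
  "rate_bound Q C12 C21 =
     (SUP p. max (if admissible12 Q C12 p then ereal (rate12 Q C12 C21 p) else -\<infinity>)
                 (if admissible21 Q C21 p then ereal (rate21 Q C12 C21 p) else -\<infinity>))"

end

theory Submission
  imports Defs "HOL-Real_Asymp.Real_Asymp"
begin

text \<open>
  Random coding, with information density thresholds in place of typical sets.  Receiver 1 sends a
  random hash of its output block at rate \<open>C12\<close>.  Receiver 2 looks for the only code word \<open>x\<close> for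
  which some block \<open>y\<close> in the announced bin makes both
  \<open>Q (y, z | x) / P (y, z)\<close> and \<open>Q (y, z | x) / P (z)\<close> large, and answers with a random hash of the
  message at rate \<open>C21\<close>; receiver 1 then looks for the only code word \<open>x\<close> with this hash for which
  \<open>Q (y | x) / P (y)\<close> is large.  A wrong code word is independent of the outputs, so a likelihood
  ratio exceeds \<open>G\<close> with probability at most \<open>1 / G\<close>: the first threshold rules out a wrong code
  word together with the true \<open>y\<close>, the second one, summed over \<open>y\<close>, a wrong code word together with
  a wrong \<open>y\<close>, which in addition has to collide with the true one.  By the law of large numbers the
  transmitted code word passes as long as the exponents are below \<open>I(X; Y1, Y2)\<close>,
  \<open>I(X; Y2) - H(Y1 | Y2, X)\<close> and \<open>I(X; Y1)\<close>, which gives the rate \<open>R12\<close> because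
  \<open>I(X; Y1, Y2) = I(X; Y2) - H(Y1 | Y2, X) + H(Y1 | Y2)\<close>.
\<close>

section \<open>Information quantities as expectations\<close>

lemma distributed_measure_pmf:
  "distributed (measure_pmf P) (count_space UNIV) U (pmf (map_pmf U P))"
proof -
  have "distr (measure_pmf P) (count_space UNIV) U = measure_pmf (map_pmf U P)"
    by (simp add: map_pmf_rep_eq)
  then show ?thesis
    by (simp add: distributed_def measure_pmf_eq_density)
qed

text \<open>The library formulas for information quantities ask for a joint density with respect to
  the product measure; for finite types this product is again a counting measure.\<close>

lemma distributed_measure_pmf_pair:
  fixes U :: "'a \<Rightarrow> 'b::finite" and V :: "'a \<Rightarrow> 'c::finite"
  shows "distributed (measure_pmf P) (count_space UNIV \<Otimes>\<^sub>M count_space UNIV)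
           (\<lambda>\<omega>. (U \<omega>, V \<omega>)) (pmf (map_pmf (\<lambda>\<omega>. (U \<omega>, V \<omega>)) P))"
  using distributed_measure_pmf[of P "\<lambda>\<omega>. (U \<omega>, V \<omega>)"] by (simp add: pair_measure_count_space)

lemma expectation_eq_sum_pmf:
  fixes V :: "'a \<Rightarrow> 'b::finite" and h :: "'b \<Rightarrow> real"
  shows "measure_pmf.expectation P (\<lambda>\<omega>. h (V \<omega>)) = (\<Sum>v\<in>UNIV. pmf (map_pmf V P) v * h v)"
proof -
  have "measure_pmf.expectation P (\<lambda>\<omega>. h (V \<omega>)) = measure_pmf.expectation (map_pmf V P) h"
    by simp
  also have "\<dots> = (\<Sum>v\<in>UNIV. pmf (map_pmf V P) v * h v)"
    by (subst integral_measure_pmf[of UNIV]) simp_all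
  finally show ?thesis .
qed

text \<open>Puts the measure-theoretic definition into the form of a mean log-likelihood ratio, to
  which the law of large numbers applies. Points outside the support have weight zero, so the
  conventions for logarithm and division at 0 do not matter.\<close>

lemma mutual_info_eq_expectation:
  fixes U :: "'a \<Rightarrow> 'b::finite" and V :: "'a \<Rightarrow> 'c::finite"
  shows "mutual_info P U V = measure_pmf.expectation P
           (\<lambda>\<omega>. log 2 (pmf (map_pmf (\<lambda>\<omega>. (U \<omega>, V \<omega>)) P) (U \<omega>, V \<omega>)
                     / (pmf (map_pmf U P) (U \<omega>) * pmf (map_pmf V P) (V \<omega>))))"
proof -
  interpret information_space "measure_pmf P" 2
    by unfold_locales simp
  show ?thesis
    unfolding mutual_info_def
    by (subst mutual_information_distr[OF sigma_finite_measure_count_space_finite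
          sigma_finite_measure_count_space_finite distributed_measure_pmf _ distributed_measure_pmf _
          distributed_measure_pmf_pair])
      (auto simp: expectation_eq_sum_pmf[where V = "\<lambda>\<omega>. (U \<omega>, V \<omega>)"
            and h = "\<lambda>(u, v). log 2 (pmf (map_pmf (\<lambda>\<omega>. (U \<omega>, V \<omega>)) P) (u, v)
               / (pmf (map_pmf U P) u * pmf (map_pmf V P) v))", simplified]
          pair_measure_count_space lebesgue_integral_count_space_finite split_beta')
qed

lemma cond_entropy_eq_expectation:
  fixes U :: "'a \<Rightarrow> 'b::finite" and V :: "'a \<Rightarrow> 'c::finite"
  shows "cond_entropy P U V = - measure_pmf.expectation P
           (\<lambda>\<omega>. log 2 (pmf (map_pmf (\<lambda>\<omega>. (U \<omega>, V \<omega>)) P) (U \<omega>, V \<omega>) / pmf (map_pmf V P) (V \<omega>)))"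
proof -
  interpret information_space "measure_pmf P" 2
    by unfold_locales simp
  show ?thesis
    unfolding cond_entropy_def
    by (subst conditional_entropy_generic_eq[OF sigma_finite_measure_count_space_finite
          sigma_finite_measure_count_space_finite distributed_measure_pmf _
          distributed_measure_pmf_pair])
      (auto simp: expectation_eq_sum_pmf[where V = "\<lambda>\<omega>. (U \<omega>, V \<omega>)"
            and h = "\<lambda>(u, v). log 2 (pmf (map_pmf (\<lambda>\<omega>. (U \<omega>, V \<omega>)) P) (u, v)
               / pmf (map_pmf V P) v)", simplified]
          pair_measure_count_space lebesgue_integral_count_space_finite split_beta')
qed

lemma mutual_info_map_pmf:
  fixes U :: "'a \<Rightarrow> 'b::finite" and V :: "'a \<Rightarrow> 'c::finite"
  shows "mutual_info (map_pmf h P) U V = mutual_info P (U \<circ> h) (V \<circ> h)"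
  by (simp add: mutual_info_eq_expectation pmf.map_comp o_def)

lemma cond_entropy_map_pmf:
  fixes U :: "'a \<Rightarrow> 'b::finite" and V :: "'a \<Rightarrow> 'c::finite"
  shows "cond_entropy (map_pmf h P) U V = cond_entropy P (U \<circ> h) (V \<circ> h)"
  by (simp add: cond_entropy_eq_expectation pmf.map_comp o_def)

lemma pmf_bind_map_Pair:
  "pmf (bind_pmf p (\<lambda>x. map_pmf (Pair x) (k x))) (x, v) = pmf p x * pmf (k x) v"
proof -
  have "pmf (bind_pmf p (\<lambda>x. map_pmf (Pair x) (k x))) (x, v)
      = measure_pmf.expectation p (\<lambda>x'. pmf (k x) v * indicator {x} x')"
    unfolding pmf_bind
  proof (rule Bochner_Integration.integral_cong)
    show "pmf (map_pmf (Pair x') (k x')) (x, v) = pmf (k x) v * indicator {x} x'" for x'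
      using pmf_map_inj'[of "Pair x'" "k x'" v] pmf_map_outside[of "(x, v)" "Pair x'" "k x'"]
      by (cases "x' = x") (auto simp: inj_on_def)
  qed simp
  then show ?thesis
    by (simp add: measure_pmf_single)
qed

lemma map_pmf_joint:
  "map_pmf inX (joint Q p) = p"
  "map_pmf outY1 (joint Q p) = map_pmf fst (bind_pmf p Q)"
  "map_pmf outY2 (joint Q p) = map_pmf snd (bind_pmf p Q)"
  "map_pmf (\<lambda>\<omega>. (outY1 \<omega>, outY2 \<omega>)) (joint Q p) = bind_pmf p Q"
  by (simp_all add: joint_def map_bind_pmf pmf.map_comp o_def inX_def outY1_def outY2_def
      bind_return_pmf' fst_def[symmetric] snd_def[symmetric] split_def)

lemma pmf_map_joint:
  "pmf (map_pmf (\<lambda>\<omega>. (inX \<omega>, outY1 \<omega>)) (joint Q p)) (x, y) = pmf p x * pmf (map_pmf fst (Q x)) y"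
  "pmf (map_pmf (\<lambda>\<omega>. (inX \<omega>, outY2 \<omega>)) (joint Q p)) (x, z) = pmf p x * pmf (map_pmf snd (Q x)) z"
  "pmf (map_pmf (\<lambda>\<omega>. (outY2 \<omega>, inX \<omega>)) (joint Q p)) (z, x) = pmf p x * pmf (map_pmf snd (Q x)) z"
  "pmf (map_pmf (\<lambda>\<omega>. (outY1 \<omega>, outY2 \<omega>, inX \<omega>)) (joint Q p)) (y, z, x) = pmf p x * pmf (Q x) (y, z)"
proof -
  have 1: "map_pmf (\<lambda>\<omega>. (inX \<omega>, outY1 \<omega>)) (joint Q p)
      = bind_pmf p (\<lambda>x. map_pmf (Pair x) (map_pmf fst (Q x)))"
    by (simp add: joint_def map_bind_pmf pmf.map_comp o_def inX_def outY1_def split_def)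
  then show "pmf (map_pmf (\<lambda>\<omega>. (inX \<omega>, outY1 \<omega>)) (joint Q p)) (x, y)
      = pmf p x * pmf (map_pmf fst (Q x)) y"
    by (simp add: pmf_bind_map_Pair del: pmf.map_comp)
  have 2: "map_pmf (\<lambda>\<omega>. (inX \<omega>, outY2 \<omega>)) (joint Q p)
      = bind_pmf p (\<lambda>x. map_pmf (Pair x) (map_pmf snd (Q x)))"
    by (simp add: joint_def map_bind_pmf pmf.map_comp o_def inX_def outY2_def split_def)
  then show *: "pmf (map_pmf (\<lambda>\<omega>. (inX \<omega>, outY2 \<omega>)) (joint Q p)) (x, z)
      = pmf p x * pmf (map_pmf snd (Q x)) z"
    by (simp add: pmf_bind_map_Pair del: pmf.map_comp)
  have "map_pmf (\<lambda>\<omega>. (outY2 \<omega>, inX \<omega>)) (joint Q p)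
      = map_pmf prod.swap (map_pmf (\<lambda>\<omega>. (inX \<omega>, outY2 \<omega>)) (joint Q p))"
    by (simp add: pmf.map_comp o_def)
  then show "pmf (map_pmf (\<lambda>\<omega>. (outY2 \<omega>, inX \<omega>)) (joint Q p)) (z, x)
      = pmf p x * pmf (map_pmf snd (Q x)) z"
    using pmf_map_inj'[OF inj_swap, of "map_pmf (\<lambda>\<omega>. (inX \<omega>, outY2 \<omega>)) (joint Q p)" "(x, z)"] *
    by (simp del: pmf.map_comp)
  have inj: "inj (\<lambda>\<omega>. (outY1 \<omega>, outY2 \<omega>, inX \<omega>))"
    by (auto simp: inj_on_def inX_def outY1_def outY2_def)
  show "pmf (map_pmf (\<lambda>\<omega>. (outY1 \<omega>, outY2 \<omega>, inX \<omega>)) (joint Q p)) (y, z, x)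
      = pmf p x * pmf (Q x) (y, z)"
    using pmf_map_inj'[OF inj, of "joint Q p" "(x, y, z)"] pmf_bind_map_Pair[of p Q x "(y, z)"]
    by (simp add: joint_def inX_def outY1_def outY2_def)
qed

section \<open>Information densities and their means\<close>

definition density_1 :: "('x \<Rightarrow> ('y \<times> 'z) pmf) \<Rightarrow> 'x pmf \<Rightarrow> 'x \<times> 'y \<times> 'z \<Rightarrow> real" where
  "density_1 Q p = (\<lambda>(x, y, z). log 2 (pmf (map_pmf fst (Q x)) y / pmf (map_pmf fst (bind_pmf p Q)) y))"

definition density_12 :: "('x \<Rightarrow> ('y \<times> 'z) pmf) \<Rightarrow> 'x pmf \<Rightarrow> 'x \<times> 'y \<times> 'z \<Rightarrow> real" where
  "density_12 Q p = (\<lambda>(x, y, z). log 2 (pmf (Q x) (y, z) / pmf (bind_pmf p Q) (y, z)))"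

text \<open>A mixed ratio: both outputs in the numerator, only receiver 2's output in the
  denominator. It factors as \<open>Q (z | x) / P (z)\<close> times \<open>Q (y | z, x)\<close>, so
  its mean is a mutual information minus a conditional entropy.\<close>

definition density_bin :: "('x \<Rightarrow> ('y \<times> 'z) pmf) \<Rightarrow> 'x pmf \<Rightarrow> 'x \<times> 'y \<times> 'z \<Rightarrow> real" where
  "density_bin Q p = (\<lambda>(x, y, z). log 2 (pmf (Q x) (y, z) / pmf (map_pmf snd (bind_pmf p Q)) z))"

text \<open>Allows logarithms of products and quotients to be split on the support.\<close>

lemma set_joint_pos:
  assumes "(x, y, z) \<in> set_pmf (joint Q p)"
  shows "0 < pmf p x" "0 < pmf (Q x) (y, z)" "0 < pmf (map_pmf fst (Q x)) y"
    "0 < pmf (map_pmf snd (Q x)) z" "0 < pmf (bind_pmf p Q) (y, z)"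
    "0 < pmf (map_pmf fst (bind_pmf p Q)) y" "0 < pmf (map_pmf snd (bind_pmf p Q)) z"
proof -
  have x: "x \<in> set_pmf p" and yz: "(y, z) \<in> set_pmf (Q x)"
    using assms by (auto simp: joint_def)
  show "0 < pmf p x" "0 < pmf (Q x) (y, z)"
    using x yz by (simp_all add: pmf_positive_iff)
  show "0 < pmf (map_pmf fst (Q x)) y" "0 < pmf (map_pmf snd (Q x)) z"
    using yz by (force simp: pmf_positive_iff)+
  have "(y, z) \<in> set_pmf (bind_pmf p Q)"
    using x yz by auto
  then show "0 < pmf (bind_pmf p Q) (y, z)" "0 < pmf (map_pmf fst (bind_pmf p Q)) y"
    "0 < pmf (map_pmf snd (bind_pmf p Q)) z"
    by (force simp: pmf_positive_iff simp del: set_bind_pmf)+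
qed

text \<open>All three means come from pointwise identities on the support. The chain rule splits
  \<open>density_bin\<close> into the density of I(X; Y2) and \<open>log 2\<close> of Q(y | z, x);
  \<open>density_12\<close> differs from \<open>density_bin\<close> by \<open>log 2\<close> of P(y |
  z), which accounts for H(Y1 | Y2).\<close>

lemma
  fixes Q :: "'x::finite \<Rightarrow> ('y::finite \<times> 'z::finite) pmf"
  shows expectation_density_1:
      "measure_pmf.expectation (joint Q p) (density_1 Q p) = mutual_info (joint Q p) inX outY1"
    and expectation_density_bin:
      "measure_pmf.expectation (joint Q p) (density_bin Q p) =
         mutual_info (joint Q p) inX outY2 - cond_entropy (joint Q p) outY1 (\<lambda>\<omega>. (outY2 \<omega>, inX \<omega>))"
    and expectation_density_12:
      "measure_pmf.expectation (joint Q p) (density_12 Q p) =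
         mutual_info (joint Q p) inX outY2 - cond_entropy (joint Q p) outY1 (\<lambda>\<omega>. (outY2 \<omega>, inX \<omega>))
           + cond_entropy (joint Q p) outY1 outY2"
proof -
  note int = integrable_measure_pmf_finite[OF finite]
  note pos = set_joint_pos
  have sel: "inX (x, y, z) = x" "outY1 (x, y, z) = y" "outY2 (x, y, z) = z" for x :: 'x and y :: 'y and z :: 'z
    by (simp_all add: inX_def outY1_def outY2_def)
  show "measure_pmf.expectation (joint Q p) (density_1 Q p) = mutual_info (joint Q p) inX outY1"
    unfolding mutual_info_eq_expectation
    by (rule integral_cong_AE)
      (auto simp: AE_measure_pmf_iff density_1_def sel pmf_map_joint map_pmf_joint dest: pos)
  show bin: "measure_pmf.expectation (joint Q p) (density_bin Q p) =
         mutual_info (joint Q p) inX outY2 - cond_entropy (joint Q p) outY1 (\<lambda>\<omega>. (outY2 \<omega>, inX \<omega>))"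
    unfolding mutual_info_eq_expectation cond_entropy_eq_expectation diff_minus_eq_add
    unfolding Bochner_Integration.integral_add[symmetric, OF int int]
  proof (rule integral_cong_AE, simp_all add: AE_measure_pmf_iff, clarify)
    fix x y z assume "(x, y, z) \<in> set_pmf (joint Q p)"
    note pos = set_joint_pos[OF this]
    then show "density_bin Q p (x, y, z) =
        log 2 (pmf (map_pmf (\<lambda>\<omega>. (inX \<omega>, outY2 \<omega>)) (joint Q p)) (inX (x, y, z), outY2 (x, y, z)) /
          (pmf (map_pmf inX (joint Q p)) (inX (x, y, z)) * pmf (map_pmf outY2 (joint Q p)) (outY2 (x, y, z)))) +
        log 2 (pmf (map_pmf (\<lambda>\<omega>. (outY1 \<omega>, outY2 \<omega>, inX \<omega>)) (joint Q p))
            (outY1 (x, y, z), outY2 (x, y, z), inX (x, y, z)) /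
          pmf (map_pmf (\<lambda>\<omega>. (outY2 \<omega>, inX \<omega>)) (joint Q p)) (outY2 (x, y, z), inX (x, y, z)))"
      by (simp add: density_bin_def sel pmf_map_joint map_pmf_joint log_divide)
  qed
  show "measure_pmf.expectation (joint Q p) (density_12 Q p) =
         mutual_info (joint Q p) inX outY2 - cond_entropy (joint Q p) outY1 (\<lambda>\<omega>. (outY2 \<omega>, inX \<omega>))
           + cond_entropy (joint Q p) outY1 outY2"
    unfolding bin[symmetric]
    unfolding cond_entropy_eq_expectation add_uminus_conv_diff
    unfolding Bochner_Integration.integral_diff[symmetric, OF int int]
  proof (rule integral_cong_AE, simp_all add: AE_measure_pmf_iff, clarify)
    fix x y z assume "(x, y, z) \<in> set_pmf (joint Q p)"
    note pos = set_joint_pos[OF this]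
    then show "density_12 Q p (x, y, z) = density_bin Q p (x, y, z) -
        log 2 (pmf (map_pmf (\<lambda>\<omega>. (outY1 \<omega>, outY2 \<omega>)) (joint Q p)) (outY1 (x, y, z), outY2 (x, y, z)) /
          pmf (map_pmf outY2 (joint Q p)) (outY2 (x, y, z)))"
      by (simp add: density_bin_def density_12_def sel map_pmf_joint log_divide)
  qed
qed

section \<open>A one-shot bound by random coding\<close>

text \<open>Serves twice: for two values of a random hash and for two code words of the random code
  book.\<close>

lemma Pi_pmf_two_components:
  assumes "finite A" "a \<in> A" "b \<in> A" "a \<noteq> b"
  shows "map_pmf (\<lambda>f. (f a, f b)) (Pi_pmf A d p) = pair_pmf (p a) (p b)"
proof -
  have "map_pmf (\<lambda>f. (f a, f b)) (Pi_pmf (insert a (A - {a})) d p)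
      = map_pmf (\<lambda>(y, f). (y, f b)) (pair_pmf (p a) (Pi_pmf (A - {a}) d p))"
    using assms by (subst Pi_pmf_insert) (auto simp: pmf.map_comp o_def split_def)
  also have "\<dots> = pair_pmf (p a) (map_pmf (\<lambda>f. f b) (Pi_pmf (A - {a}) d p))"
    unfolding pair_map_pmf2 by (simp add: apsnd_def map_prod_def)
  also have "\<dots> = pair_pmf (p a) (p b)"
    using assms by (simp add: Pi_pmf_component)
  finally show ?thesis
    using assms by (simp add: insert_absorb)
qed

lemma emeasure_pair_pmf:
  "emeasure (measure_pmf (pair_pmf p q)) A = (\<integral>\<^sup>+ x. emeasure (measure_pmf q) {v. (x, v) \<in> A} \<partial>p)"
  unfolding pair_pmf_def
  by (auto simp: indicator_def nn_integral_indicator[symmetric]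
      intro!: nn_integral_cong simp del: nn_integral_indicator)

text \<open>Given one of the two hash values, the other is still uniform on \<open>L\<close>
  values.\<close>

lemma random_hash_collision:
  fixes L :: nat
  assumes "finite A" "a \<in> A" "b \<in> A" "a \<noteq> b" "1 \<le> L"
  shows "emeasure (Pi_pmf A d (\<lambda>_. pmf_of_set {1..L})) {f. f a = f b} = ennreal (1 / real L)"
proof -
  let ?u = "pmf_of_set {1..L}"
  have "emeasure (Pi_pmf A d (\<lambda>_. ?u)) {f. f a = f b}
      = emeasure (map_pmf (\<lambda>f. (f a, f b)) (Pi_pmf A d (\<lambda>_. ?u))) {(u, v). u = v}"
    by (simp add: vimage_def)
  also have "\<dots> = emeasure (pair_pmf ?u ?u) {(u, v). u = v}"
    using assms by (subst Pi_pmf_two_components) auto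
  also have "\<dots> = (\<integral>\<^sup>+ v. emeasure ?u {v} \<partial>?u)"
    by (simp add: emeasure_pair_pmf)
  also have "\<dots> = (\<integral>\<^sup>+ v. ennreal (1 / real L) \<partial>?u)"
    using assms(5) by (intro nn_integral_cong_AE) (auto simp: AE_measure_pmf_iff emeasure_pmf_single)
  finally show ?thesis
    by simp
qed

text \<open>Change of measure: on the event, \<open>pmf q z\<close> is at most
  \<open>pmf (k x) (y, z) / G\<close>, so the term for \<open>y\<close> is at most
  \<open>1 / G\<close> times the mass that \<open>k x\<close> gives to first component
  \<open>y\<close>. These masses add up to at most 1, so the whole union over \<open>y\<close> costs
  a single \<open>1 / G\<close>.\<close>

lemma likelihood_ratio_test_sum:
  fixes G :: real
  assumes "0 < G" "finite S"
  shows "(\<Sum>y\<in>S. emeasure (pair_pmf p q) {(x, z). G * pmf q z \<le> pmf (k x) (y, z)}) \<le> ennreal (1 / G)"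
proof -
  have "(\<Sum>y\<in>S. emeasure (pair_pmf p q) {(x, z). G * pmf q z \<le> pmf (k x) (y, z)})
      = (\<integral>\<^sup>+ x. (\<Sum>y\<in>S. emeasure q {z. G * pmf q z \<le> pmf (k x) (y, z)}) \<partial>p)"
    by (simp add: emeasure_pair_pmf nn_integral_sum)
  also have "\<dots> \<le> (\<integral>\<^sup>+ x. ennreal (1 / G) \<partial>p)"
  proof (rule nn_integral_mono)
    fix x
    have "emeasure q {z. G * pmf q z \<le> pmf (k x) (y, z)}
        \<le> ennreal (1 / G) * ennreal (pmf (map_pmf fst (k x)) y)" for y
    proof -
      have "emeasure q {z. G * pmf q z \<le> pmf (k x) (y, z)}
          = (\<integral>\<^sup>+ z. ennreal (pmf q z) * indicator {z. G * pmf q z \<le> pmf (k x) (y, z)} z \<partial>count_space UNIV)"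
        by (simp add: nn_integral_pmf[symmetric] nn_integral_count_space_indicator)
      also have "\<dots> \<le> (\<integral>\<^sup>+ z. ennreal (1 / G) * ennreal (pmf (k x) (y, z)) \<partial>count_space UNIV)"
        using assms by (intro nn_integral_mono)
          (auto simp: indicator_def ennreal_mult[symmetric] field_simps intro!: ennreal_leI)
      also have "\<dots> = ennreal (1 / G) * emeasure (k x) (range (Pair y))"
        by (simp add: nn_integral_cmult nn_integral_pmf' inj_on_def)
      also have "range (Pair y) = fst -` {y}"
        by auto
      also have "emeasure (k x) (fst -` {y}) = ennreal (pmf (map_pmf fst (k x)) y)"
        by (simp add: emeasure_pmf_single[symmetric])
      finally show ?thesis .
    qed
    then have "(\<Sum>y\<in>S. emeasure q {z. G * pmf q z \<le> pmf (k x) (y, z)})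
        \<le> (\<Sum>y\<in>S. ennreal (1 / G) * ennreal (pmf (map_pmf fst (k x)) y))"
      by (intro sum_mono)
    also have "\<dots> = ennreal (1 / G) * emeasure (map_pmf fst (k x)) S"
      using assms(2)
      by (simp add: sum_distrib_left[symmetric] emeasure_measure_pmf_finite del: emeasure_map_pmf)
    also have "\<dots> \<le> ennreal (1 / G) * 1"
      by (intro mult_left_mono measure_pmf.emeasure_le_1) simp
    finally show "(\<Sum>y\<in>S. emeasure q {z. G * pmf q z \<le> pmf (k x) (y, z)}) \<le> ennreal (1 / G)"
      by simp
  qed
  finally show ?thesis
    by simp
qed

text \<open>The previous bound with a first component of type \<open>unit\<close>, so that the sum
  has one term.\<close>

lemma likelihood_ratio_test:
  fixes G :: real
  assumes "0 < G"
  shows "emeasure (pair_pmf p q) {(x, v). G * pmf q v \<le> pmf (k x) v} \<le> ennreal (1 / G)"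
proof -
  have inj: "inj (Pair ())"
    by (simp add: inj_on_def)
  show ?thesis
    using likelihood_ratio_test_sum[OF assms, of "{()}" p q "\<lambda>x. map_pmf (Pair ()) (k x)"]
    by (simp add: pmf_map_inj'[OF inj])
qed

text \<open>The probabilistic method: if \<open>u\<close> exceeded \<open>b\<close> on the whole
  support, so would its mean. Finiteness of \<open>b\<close> is what makes the comparison of
  integrals strict.\<close>

lemma exists_le_nn_integral_pmf:
  assumes "(\<integral>\<^sup>+ x. u x \<partial>measure_pmf p) \<le> b" "b < \<infinity>"
  obtains x where "x \<in> set_pmf p" "u x \<le> b"
proof -
  have "\<exists>x\<in>set_pmf p. u x \<le> b"
  proof (rule ccontr)
    assume "\<not> ?thesis"
    then have gt: "b < u x" if "x \<in> set_pmf p" for x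
      using that by (meson not_le)
    have "(\<integral>\<^sup>+ x. b \<partial>measure_pmf p) < (\<integral>\<^sup>+ x. u x \<partial>measure_pmf p)"
      using assms(2) gt set_pmf_not_empty[of p]
      by (intro nn_integral_less)
        (auto simp: AE_measure_pmf_iff less_imp_le not_le ex_in_conv[symmetric]
          dest!: bspec)
    then show False
      using assms(1) by (simp add: not_less[symmetric])
  qed
  then show ?thesis
    using that by blast
qed

lemma emeasure_pair_pmf_fst: "emeasure (measure_pmf (pair_pmf p q)) {h. P (fst h)} = emeasure (measure_pmf p) {x. P x}"
proof -
  have "emeasure p {x. P x} = emeasure (map_pmf fst (pair_pmf p q)) {x. P x}"
    by (simp only: map_fst_pair_pmf)
  then show ?thesis
    by (simp only: emeasure_map_pmf vimage_Collect_eq)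
qed

lemma emeasure_pair_pmf_snd: "emeasure (measure_pmf (pair_pmf p q)) {h. P (snd h)} = emeasure (measure_pmf q) {x. P x}"
proof -
  have "emeasure q {x. P x} = emeasure (map_pmf snd (pair_pmf p q)) {x. P x}"
    by (simp only: map_snd_pair_pmf)
  then show ?thesis
    by (simp only: emeasure_map_pmf vimage_Collect_eq)
qed

lemma map_pmf_pair_triple:
  "map_pmf (\<lambda>(x, y, z). (x, z)) (pair_pmf p q) = pair_pmf p (map_pmf snd q)"
  "map_pmf (\<lambda>(x, y, z). (x, y)) (pair_pmf p q) = pair_pmf p (map_pmf fst q)"
  by (simp_all add: pair_map_pmf2 apsnd_def map_prod_def split_def)

text \<open>Conditioning on \<open>b\<close>: a bound that holds given every point of
  \<open>X\<close> multiplies the probability of \<open>X\<close>. It is applied with the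
  transmission as \<open>B\<close> and the hashes as \<open>H\<close>.\<close>

lemma emeasure_pair_pmf_conditional:
  assumes "\<And>b. b \<in> set_pmf B \<Longrightarrow> b \<in> X \<Longrightarrow> emeasure (measure_pmf H) {h. A b h} \<le> r"
  shows "emeasure (measure_pmf (pair_pmf B H)) {(b, h). b \<in> X \<and> A b h} \<le> r * emeasure (measure_pmf B) X"
proof -
  have "emeasure (pair_pmf B H) {(b, h). b \<in> X \<and> A b h}
      = (\<integral>\<^sup>+ b. emeasure H {h. b \<in> X \<and> A b h} \<partial>B)"
    by (simp add: emeasure_pair_pmf)
  also have "\<dots> \<le> (\<integral>\<^sup>+ b. r * indicator X b \<partial>B)"
    using assms by (intro nn_integral_mono_AE) (auto simp: AE_measure_pmf_iff indicator_def)
  also have "\<dots> = r * emeasure B X"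
    by (simp add: nn_integral_cmult)
  finally show ?thesis .
qed

section \<open>Decoders by unique survival\<close>

text \<open>The fallback 1 keeps the answer inside the message set when no or several candidates
  survive.\<close>

definition select :: "nat \<Rightarrow> (nat \<Rightarrow> bool) \<Rightarrow> nat" where
  "select M P = (if \<exists>!w. w \<in> {1..M} \<and> P w then THE w. w \<in> {1..M} \<and> P w else 1)"

lemma select_eq:
  assumes "w \<in> {1..M}" "P w" "\<And>w'. w' \<in> {1..M} \<Longrightarrow> P w' \<Longrightarrow> w' = w"
  shows "select M P = w"
proof -
  have "\<exists>!w. w \<in> {1..M} \<and> P w" and "(THE w. w \<in> {1..M} \<and> P w) = w"
    using assms by (blast intro: the_equality)+
  then show ?thesis
    by (simp add: select_def)
qed

lemma select_in:
  assumes "1 \<le> M"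
  shows "select M P \<in> {1..M}"
proof (cases "\<exists>!w. w \<in> {1..M} \<and> P w")
  case True
  then show ?thesis
    using theI'[OF True] by (simp add: select_def)
next
  case False
  then show ?thesis
    using assms by (auto simp: select_def)
qed

text \<open>Receiver 2's decoder, with \<open>h\<close> the announced bin. The block
  \<open>y\<close> is only a witness: several blocks of the bin may support the same message, and
  only the message has to be unique.\<close>

definition dec_bin :: "('a \<times> 'b \<times> 'c) set \<Rightarrow> 'b set \<Rightarrow> nat \<Rightarrow> (nat \<Rightarrow> 'a) \<Rightarrow> ('b \<Rightarrow> nat) \<Rightarrow> nat \<Rightarrow> 'c \<Rightarrow> nat" where
  "dec_bin T S M c f h z = select M (\<lambda>w. \<exists>y\<in>S. f y = h \<and> (c w, y, z) \<in> T)"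

text \<open>Receiver 1's decoder, with \<open>k\<close> the message hash announced by receiver
  2.\<close>

definition dec_list :: "('a \<times> 'b) set \<Rightarrow> nat \<Rightarrow> (nat \<Rightarrow> 'a) \<Rightarrow> (nat \<Rightarrow> nat) \<Rightarrow> nat \<Rightarrow> 'b \<Rightarrow> nat" where
  "dec_list T1 M c g k y = select M (\<lambda>w. g w = k \<and> (c w, y) \<in> T1)"

text \<open>The last three assumptions exclude the three ways in which a wrong message can survive:
  with the true block, with a wrong block in the same bin, or at receiver 1 with a colliding message
  hash. Then \<open>w\<close> is the only survivor in both searches.\<close>

lemma decoding_correct:
  assumes w: "w \<in> {1..M}" and y: "y \<in> S" and T: "(c w, y, z) \<in> T" and T1: "(c w, y) \<in> T1"
    and other: "\<And>w'. w' \<in> {1..M} - {w} \<Longrightarrow> (c w', y, z) \<notin> T"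
      "\<And>w' y'. w' \<in> {1..M} - {w} \<Longrightarrow> y' \<in> S - {y} \<Longrightarrow> f y' = f y \<Longrightarrow> (c w', y', z) \<notin> T"
      "\<And>w'. w' \<in> {1..M} - {w} \<Longrightarrow> g w' = g w \<Longrightarrow> (c w', y) \<notin> T1"
  shows "dec_bin T S M c f (f y) z = w" "dec_list T1 M c g (g w) y = w"
proof -
  show "dec_bin T S M c f (f y) z = w"
    unfolding dec_bin_def
  proof (rule select_eq[OF w])
    fix w' assume "w' \<in> {1..M}" and "\<exists>y'\<in>S. f y' = f y \<and> (c w', y', z) \<in> T"
    then show "w' = w"
      using other(1)[of w'] other(2)[of w'] by (metis Diff_iff singletonD)
  qed (use y T in blast)
  show "dec_list T1 M c g (g w) y = w"
    unfolding dec_list_def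
  proof (rule select_eq[OF w])
    fix w' assume "w' \<in> {1..M}" and "g w' = g w \<and> (c w', y) \<in> T1"
    then show "w' = w"
      using other(3)[of w'] by blast
  qed (use T1 in blast)
qed

section \<open>The random code and its average error probability\<close>

text \<open>The acceptance sets \<open>T\<close> and \<open>T1\<close> are arbitrary here;
  likelihood thresholds are inserted only in \<open>one_shot_code\<close>. \<open>S\<close> contains
  all possible outputs of receiver 1 and is the domain of its hash.\<close>

locale random_code =
  fixes p :: "'a pmf" and K :: "'a \<Rightarrow> ('b \<times> 'c) pmf" and S :: "'b set"
    and T :: "('a \<times> 'b \<times> 'c) set" and T1 :: "('a \<times> 'b) set"
    and M L12 L21 :: nat
  assumes finite_S: "finite S" and output_in_S: "\<And>x. fst ` set_pmf (K x) \<subseteq> S"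
    and M_pos: "1 \<le> M" and L12_pos: "1 \<le> L12" and L21_pos: "1 \<le> L21"
begin

definition codebook :: "(nat \<Rightarrow> 'a) pmf" where
  "codebook = Pi_pmf {1..M} undefined (\<lambda>_. p)"

definition hashes :: "(('b \<Rightarrow> nat) \<times> (nat \<Rightarrow> nat)) pmf" where
  "hashes = pair_pmf (Pi_pmf S 1 (\<lambda>_. pmf_of_set {1..L12})) (Pi_pmf {1..M} 1 (\<lambda>_. pmf_of_set {1..L21}))"

definition transmission :: "nat \<Rightarrow> ((nat \<Rightarrow> 'a) \<times> 'b \<times> 'c) pmf" where
  "transmission w = bind_pmf codebook (\<lambda>c. map_pmf (Pair c) (K (c w)))"

text \<open>The hash sent back is that of receiver 2's decision, not of the true message. The two
  agree once receiver 2 is right, which is why \<open>decoding_correct\<close> may speak of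
  \<open>g w\<close>.\<close>

definition fails :: "nat \<Rightarrow> (nat \<Rightarrow> 'a) \<Rightarrow> ('b \<Rightarrow> nat) \<times> (nat \<Rightarrow> nat) \<Rightarrow> 'b \<times> 'c \<Rightarrow> bool" where
  "fails w c = (\<lambda>(f, g) (y, z). dec_bin T S M c f (f y) z \<noteq> w \<or>
     dec_list T1 M c g (g (dec_bin T S M c f (f y) z)) y \<noteq> w)"

lemma transmission_component:
  assumes "w \<in> {1..M}"
  shows "map_pmf (\<lambda>(c, v). (c w, v)) (transmission w) = joint K p"
proof -
  have "map_pmf (\<lambda>(c, v). (c w, v)) (transmission w)
      = bind_pmf (map_pmf (\<lambda>c. c w) codebook) (\<lambda>x. map_pmf (Pair x) (K x))"
    by (simp add: transmission_def map_bind_pmf pmf.map_comp o_def bind_map_pmf)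
  also have "map_pmf (\<lambda>c. c w) codebook = p"
    using assms by (simp add: codebook_def Pi_pmf_component)
  finally show ?thesis
    by (simp add: joint_def)
qed

text \<open>A code word that was not sent is independent of the sent one, hence of the outputs;
  averaging over the sent word leaves the output law \<open>bind_pmf p K\<close>.\<close>

lemma transmission_other_component:
  assumes "w \<in> {1..M}" "w' \<in> {1..M}" "w' \<noteq> w"
  shows "map_pmf (\<lambda>(c, v). (c w', v)) (transmission w) = pair_pmf p (bind_pmf p K)"
proof -
  have "map_pmf (\<lambda>(c, v). (c w', v)) (transmission w)
      = bind_pmf (map_pmf (\<lambda>c. (c w', c w)) codebook) (\<lambda>(x', x). map_pmf (Pair x') (K x))"
    by (simp add: transmission_def map_bind_pmf pmf.map_comp o_def bind_map_pmf)
  also have "map_pmf (\<lambda>c. (c w', c w)) codebook = pair_pmf p p"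
    using assms by (simp add: codebook_def Pi_pmf_two_components)
  also have "bind_pmf (pair_pmf p p) (\<lambda>(x', x). map_pmf (Pair x') (K x)) = pair_pmf p (bind_pmf p K)"
    by (simp add: pair_pmf_def bind_assoc_pmf bind_return_pmf map_pmf_def)
  finally show ?thesis .
qed

lemma transmission_output:
  assumes "(c, y, z) \<in> set_pmf (transmission w)"
  shows "y \<in> S"
  using assms output_in_S by (force simp: transmission_def)

text \<open>A bound for the probability that one fixed wrong message survives; the summands match
  the three cases excluded in \<open>decoding_correct\<close>.\<close>

definition confusion :: ennreal where
  "confusion = emeasure (pair_pmf p (bind_pmf p K)) T
     + ennreal (1 / real L12) * (\<Sum>y\<in>S. emeasure (pair_pmf p (map_pmf snd (bind_pmf p K))) {(x, z). (x, y, z) \<in> T})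
     + ennreal (1 / real L21) * emeasure (pair_pmf p (map_pmf fst (bind_pmf p K))) T1"

text \<open>A union bound: either the sent word fails a test, or one of fewer than \<open>M\<close>
  wrong messages survives.\<close>

lemma emeasure_fails:
  assumes w: "w \<in> {1..M}"
  shows "emeasure (pair_pmf (transmission w) hashes) {((c, v), h). fails w c h v}
     \<le> emeasure (joint K p) {v. v \<notin> T} + emeasure (joint K p) {(x, y, z). (x, y) \<notin> T1}
        + of_nat M * confusion"
proof -
  let ?D = "pair_pmf (transmission w) hashes"
  \<comment> \<open>\<open>A0\<close> and \<open>A1\<close>: the sent word is rejected.
    \<open>B\<close>, \<open>C\<close>, \<open>D\<close>: the three confusions with a wrong
    \<open>w'\<close>, where \<open>X\<close> and \<open>Y\<close> are the conditions of
    \<open>C\<close> and \<open>D\<close> that do not involve the hashes.\<close>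
  define A0 where "A0 = {((c, y, z), h :: ('b \<Rightarrow> nat) \<times> (nat \<Rightarrow> nat)). (c w, y, z) \<notin> T}"
  define A1 where "A1 = {((c, y, z :: 'c), h :: ('b \<Rightarrow> nat) \<times> (nat \<Rightarrow> nat)). (c w, y) \<notin> T1}"
  define B where "B w' = {((c, y, z), h :: ('b \<Rightarrow> nat) \<times> (nat \<Rightarrow> nat)). (c w', y, z) \<in> T}" for w' :: nat
  define X where "X w' y' = {(c, y :: 'b, z). (c w', y', z) \<in> T \<and> y' \<noteq> y}" for w' :: nat and y'
  define C where "C w' y' = {(b, f, g :: nat \<Rightarrow> nat). b \<in> X w' y' \<and> f y' = (f (fst (snd b)) :: nat)}" for w' y'
  define Y where "Y w' = {(c, y, z :: 'c). (c w', y) \<in> T1}" for w' :: nat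
  define D where "D w' = {(b, f :: 'b \<Rightarrow> nat, g). b \<in> Y w' \<and> g w' = (g w :: nat)}" for w'
  let ?W = "{1..M} - {w}"
  \<comment> \<open>Intersecting with the support guarantees that the true block lies in
    \<open>S\<close>.\<close>
  have sub: "{((c, v), h). fails w c h v} \<inter> set_pmf ?D
      \<subseteq> A0 \<union> A1 \<union> (\<Union>w'\<in>?W. B w' \<union> (\<Union>y'\<in>S. C w' y') \<union> D w')"
  proof
    fix \<omega>
    assume \<omega>: "\<omega> \<in> {((c, v), h). fails w c h v} \<inter> set_pmf ?D"
    obtain c y z f g where eq: "\<omega> = ((c, y, z), f, g)"
      by (metis prod.exhaust)
    have "y \<in> S" and "fails w c (f, g) (y, z)"
      using \<omega> by (auto simp: eq intro: transmission_output)
    show "\<omega> \<in> A0 \<union> A1 \<union> (\<Union>w'\<in>?W. B w' \<union> (\<Union>y'\<in>S. C w' y') \<union> D w')"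
    proof (rule ccontr)
      assume n: "\<not> ?thesis"
      have "(c w, y, z) \<in> T" "(c w, y) \<in> T1"
        using n by (auto simp: eq A0_def A1_def)
      moreover have "(c w', y, z) \<notin> T" if "w' \<in> ?W" for w'
        using n that by (auto simp: eq B_def)
      moreover have "(c w', y', z) \<notin> T" if "w' \<in> ?W" "y' \<in> S - {y}" "f y' = f y" for w' y'
        using n that by (auto simp: eq C_def X_def)
      moreover have "(c w', y) \<notin> T1" if "w' \<in> ?W" "g w' = g w" for w'
        using n that by (auto simp: eq D_def Y_def)
      ultimately show False
        using decoding_correct[of w M y S c z T T1 f g, OF w \<open>y \<in> S\<close>] \<open>fails w c (f, g) (y, z)\<close>
        by (simp add: fails_def)
    qed
  qed
  have eA0: "emeasure ?D A0 = emeasure (joint K p) {v. v \<notin> T}"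
  proof -
    have "emeasure ?D A0 = emeasure (map_pmf (\<lambda>(c, v). (c w, v)) (map_pmf fst ?D)) {v. v \<notin> T}"
      by (auto simp: A0_def vimage_def intro!: arg_cong[where f = "emeasure _"] simp del: map_fst_pair_pmf)
    then show ?thesis
      by (simp only: map_fst_pair_pmf transmission_component[OF w])
  qed
  have eA1: "emeasure ?D A1 = emeasure (joint K p) {(x, y, z). (x, y) \<notin> T1}"
  proof -
    have "emeasure ?D A1 = emeasure (map_pmf (\<lambda>(c, v). (c w, v)) (map_pmf fst ?D)) {(x, y, z). (x, y) \<notin> T1}"
      by (auto simp: A1_def vimage_def intro!: arg_cong[where f = "emeasure _"] simp del: map_fst_pair_pmf)
    then show ?thesis
      by (simp only: map_fst_pair_pmf transmission_component[OF w])
  qed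
  have eW: "emeasure ?D (B w' \<union> (\<Union>y'\<in>S. C w' y') \<union> D w') \<le> confusion" if w': "w' \<in> ?W" for w'
  proof -
    have other: "map_pmf (\<lambda>(c, v). (c w', v)) (transmission w) = pair_pmf p (bind_pmf p K)"
      using w w' by (intro transmission_other_component) auto
    have eB: "emeasure ?D (B w') = emeasure (pair_pmf p (bind_pmf p K)) T"
    proof -
      have "emeasure ?D (B w') = emeasure (map_pmf (\<lambda>(c, v). (c w', v)) (map_pmf fst ?D)) T"
        by (auto simp: B_def vimage_def intro!: arg_cong[where f = "emeasure _"] simp del: map_fst_pair_pmf)
      then show ?thesis
        by (simp only: map_fst_pair_pmf other)
    qed
    have eC: "emeasure ?D (C w' y') \<le> ennreal (1 / real L12)
        * emeasure (pair_pmf p (map_pmf snd (bind_pmf p K))) {(x, z). (x, y', z) \<in> T}" if "y' \<in> S" for y'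
    proof -
      have "emeasure ?D {(b, h). b \<in> X w' y' \<and> fst h y' = fst h (fst (snd b))}
          \<le> ennreal (1 / real L12) * emeasure (transmission w) (X w' y')"
      proof (rule emeasure_pair_pmf_conditional)
        fix b assume "b \<in> set_pmf (transmission w)" "b \<in> X w' y'"
        then have "fst (snd b) \<in> S" "y' \<noteq> fst (snd b)"
          by (auto simp: X_def intro: transmission_output)
        from random_hash_collision[OF finite_S \<open>y' \<in> S\<close> this L12_pos, of 1]
        show "emeasure hashes {h. fst h y' = fst h (fst (snd b))} \<le> ennreal (1 / real L12)"
          by (simp add: hashes_def emeasure_pair_pmf_fst[where P = "\<lambda>f. f y' = f (fst (snd b))"])
      qed
      \<comment> \<open>The condition that \<open>y'\<close> differs from the true block was needed
        for the hash collision; dropping it now leaves an event about the independent pair of wrong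
        code word and \<open>z\<close>.\<close>
      also have "emeasure (transmission w) (X w' y')
          \<le> emeasure (map_pmf (\<lambda>(x, y, z). (x, z)) (map_pmf (\<lambda>(c, v). (c w', v)) (transmission w)))
              {(x, z). (x, y', z) \<in> T}"
        by (auto simp: X_def intro!: emeasure_mono)
      also have "map_pmf (\<lambda>(x, y, z). (x, z)) (map_pmf (\<lambda>(c, v). (c w', v)) (transmission w))
          = pair_pmf p (map_pmf snd (bind_pmf p K))"
        by (simp only: other map_pmf_pair_triple)
      finally show ?thesis
        by (auto simp: C_def split_def mult_left_mono)
    qed
    have eD: "emeasure ?D (D w') \<le> ennreal (1 / real L21)
        * emeasure (pair_pmf p (map_pmf fst (bind_pmf p K))) T1"
    proof -
      have "emeasure ?D {(b, h). b \<in> Y w' \<and> snd h w' = snd h w}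
          \<le> ennreal (1 / real L21) * emeasure (transmission w) (Y w')"
      proof (rule emeasure_pair_pmf_conditional)
        from random_hash_collision[of "{1..M}" w' w L21 1] w w' L21_pos
        show "emeasure hashes {h. snd h w' = snd h w} \<le> ennreal (1 / real L21)"
          by (simp add: hashes_def emeasure_pair_pmf_snd[where P = "\<lambda>g. g w' = g w"])
      qed
      also have "emeasure (transmission w) (Y w')
          = emeasure (map_pmf (\<lambda>(x, y, z). (x, y)) (map_pmf (\<lambda>(c, v). (c w', v)) (transmission w))) T1"
        by (auto simp: Y_def vimage_def split_def intro!: arg_cong[where f = "emeasure _"])
      also have "map_pmf (\<lambda>(x, y, z). (x, y)) (map_pmf (\<lambda>(c, v). (c w', v)) (transmission w))
          = pair_pmf p (map_pmf fst (bind_pmf p K))"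
        by (simp only: other map_pmf_pair_triple)
      finally show ?thesis
        by (simp add: D_def split_def)
    qed
    have "emeasure ?D (B w' \<union> (\<Union>y'\<in>S. C w' y') \<union> D w')
        \<le> emeasure ?D (B w') + (\<Sum>y'\<in>S. emeasure ?D (C w' y')) + emeasure ?D (D w')"
      by (intro order_trans[OF emeasure_subadditive] add_mono emeasure_subadditive_finite
          order_refl finite_S) auto
    also have "\<dots> \<le> confusion"
      unfolding confusion_def sum_distrib_left
      by (intro add_mono sum_mono eC eD) (auto simp: eB)
    finally show ?thesis .
  qed
  have "emeasure ?D {((c, v), h). fails w c h v}
      = emeasure ?D ({((c, v), h). fails w c h v} \<inter> set_pmf ?D)"
    by (rule emeasure_Int_set_pmf[symmetric])
  also have "\<dots> \<le> emeasure ?D (A0 \<union> A1 \<union> (\<Union>w'\<in>?W. B w' \<union> (\<Union>y'\<in>S. C w' y') \<union> D w'))"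
    by (intro emeasure_mono sub) auto
  also have "\<dots> \<le> emeasure ?D A0 + emeasure ?D A1
      + (\<Sum>w'\<in>?W. emeasure ?D (B w' \<union> (\<Union>y'\<in>S. C w' y') \<union> D w'))"
    by (intro order_trans[OF emeasure_subadditive] add_mono emeasure_subadditive_finite order_refl) auto
  also have "(\<Sum>w'\<in>?W. emeasure ?D (B w' \<union> (\<Union>y'\<in>S. C w' y') \<union> D w')) \<le> of_nat (card ?W) * confusion"
    by (rule sum_bounded_above[OF eW])
  also have "\<dots> \<le> of_nat M * confusion"
    using card_Diff1_le[of "{1..M}" w] by (intro mult_right_mono) (simp_all del: card_Diff_insert)
  finally show ?thesis
    by (simp add: eA0 eA1 add_left_mono)
qed

text \<open>Fubini: with hashes and code book drawn first, the integrand is the error probability of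
  one fixed code for the message \<open>w\<close>.\<close>

lemma emeasure_fails_conv:
  "emeasure (pair_pmf (transmission w) hashes) {((c, v), h). fails w c h v}
     = (\<integral>\<^sup>+ (h, c). emeasure (K (c w)) {v. fails w c h v} \<partial>pair_pmf hashes codebook)"
proof -
  have "emeasure (pair_pmf (transmission w) hashes) {((c, v), h). fails w c h v}
      = emeasure (pair_pmf hashes (transmission w)) {(h, c, v). fails w c h v}"
    by (subst pair_commute_pmf)
      (auto simp: vimage_def split_def intro!: arg_cong[where f = "emeasure _"])
  also have "\<dots> = (\<integral>\<^sup>+ (h, c). emeasure (K (c w)) {v. fails w c h v} \<partial>pair_pmf hashes codebook)"
    by (simp add: emeasure_pair_pmf nn_integral_pair_pmf' transmission_def vimage_def)
  finally show ?thesis .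
qed

text \<open>The errors are summed over all messages before a code is chosen, so one code book and
  one pair of hashes serve every message.\<close>

lemma exists_good_code:
  obtains c f g where "f \<in> UNIV \<rightarrow> {1..L12}" "g \<in> UNIV \<rightarrow> {1..L21}"
    "(\<Sum>w\<in>{1..M}. emeasure (K (c w)) {v. fails w c (f, g) v})
       \<le> of_nat M * (emeasure (joint K p) {v. v \<notin> T} + emeasure (joint K p) {(x, y, z). (x, y) \<notin> T1}
            + of_nat M * confusion)"
proof -
  let ?b = "emeasure (joint K p) {v. v \<notin> T} + emeasure (joint K p) {(x, y, z). (x, y) \<notin> T1}
            + of_nat M * confusion"
  have fin: "of_nat M * ?b < \<infinity>"
    by (simp add: confusion_def ennreal_mult_less_top ennreal_of_nat_eq_real_of_nat
        measure_pmf.emeasure_eq_measure)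
  have "(\<integral>\<^sup>+ (h, c). (\<Sum>w\<in>{1..M}. emeasure (K (c w)) {v. fails w c h v}) \<partial>pair_pmf hashes codebook)
      = (\<Sum>w\<in>{1..M}. \<integral>\<^sup>+ (h, c). emeasure (K (c w)) {v. fails w c h v} \<partial>pair_pmf hashes codebook)"
    by (simp add: split_def nn_integral_sum)
  also have "\<dots> \<le> (\<Sum>w\<in>{1..M}. ?b)"
    by (intro sum_mono) (simp only: emeasure_fails_conv[symmetric] emeasure_fails)
  also have "\<dots> = of_nat M * ?b"
    by simp
  finally obtain hc where hc: "hc \<in> set_pmf (pair_pmf hashes codebook)"
      "(\<lambda>(h, c). \<Sum>w\<in>{1..M}. emeasure (K (c w)) {v. fails w c h v}) hc \<le> of_nat M * ?b"
    by (rule exists_le_nn_integral_pmf[OF _ fin])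
  obtain f g c where eq: "hc = ((f, g), c)"
    by (metis prod.exhaust)
  \<comment> \<open>The default value 1 of the product distributions is itself a valid hash value,
    so \<open>f\<close> and \<open>g\<close> take allowed values on the whole type.\<close>
  have "f \<in> PiE_dflt S 1 (\<lambda>_. {1..L12})" "g \<in> PiE_dflt {1..M} 1 (\<lambda>_. {1..L21})"
    using hc(1) L12_pos L21_pos finite_S by (auto simp: eq hashes_def set_Pi_pmf o_def)
  then have "f y \<in> {1..L12}" and "g w \<in> {1..L21}" for y w
    using L12_pos L21_pos by (auto simp: PiE_dflt_def dest!: spec[of _ y] spec[of _ w])
  then have "f \<in> UNIV \<rightarrow> {1..L12}" "g \<in> UNIV \<rightarrow> {1..L21}"
    by blast+
  with hc(2) show ?thesis
    by (intro that) (auto simp: eq)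
qed

end

text \<open>A single use of an arbitrary channel; a block will later play the role of one symbol.
  With \<open>T\<close> and \<open>T1\<close> given by likelihood ratios, the tests above bound the
  three parts of \<open>confusion\<close> by \<open>1 / Ga\<close>, \<open>1 / (L12 * Gb)\<close>
  and \<open>1 / (L21 * Gc)\<close>.\<close>

theorem one_shot_code:
  fixes p :: "'a pmf" and K :: "'a \<Rightarrow> ('b \<times> 'c) pmf" and M L12 L21 :: nat and Ga Gb Gc :: real
  assumes "finite S" "\<And>x. fst ` set_pmf (K x) \<subseteq> S" "1 \<le> M" "1 \<le> L12" "1 \<le> L21"
    and "0 < Ga" "0 < Gb" "0 < Gc"
  obtains c f g d2 d1 where
    "f \<in> UNIV \<rightarrow> {1..L12}" "g \<in> UNIV \<rightarrow> {1..L21}"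
    "d2 \<in> UNIV \<rightarrow> UNIV \<rightarrow> {1..M}" "d1 \<in> UNIV \<rightarrow> UNIV \<rightarrow> {1..M}"
    "(\<Sum>w\<in>{1..M}. measure_pmf.prob (K (c w)) {(y, z). d2 (f y) z \<noteq> w \<or> d1 (g (d2 (f y) z)) y \<noteq> w}) / M
       \<le> measure_pmf.prob (joint K p) {(x, v). pmf (K x) v < Ga * pmf (bind_pmf p K) v}
         + measure_pmf.prob (joint K p) {(x, y, z). pmf (K x) (y, z) < Gb * pmf (map_pmf snd (bind_pmf p K)) z}
         + measure_pmf.prob (joint K p) {(x, y, z). pmf (map_pmf fst (K x)) y < Gc * pmf (map_pmf fst (bind_pmf p K)) y}
         + (M / Ga + M / (L12 * Gb) + M / (L21 * Gc))"
proof -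
  define T where "T = {(x, y, z). Ga * pmf (bind_pmf p K) (y, z) \<le> pmf (K x) (y, z) \<and>
      Gb * pmf (map_pmf snd (bind_pmf p K)) z \<le> pmf (K x) (y, z)}"
  define T1 where "T1 = {(x, y). Gc * pmf (map_pmf fst (bind_pmf p K)) y \<le> pmf (map_pmf fst (K x)) y}"
  define Pa where "Pa = measure_pmf.prob (joint K p) {(x, v). pmf (K x) v < Ga * pmf (bind_pmf p K) v}"
  define Pb where "Pb = measure_pmf.prob (joint K p) {(x, y, z). pmf (K x) (y, z) < Gb * pmf (map_pmf snd (bind_pmf p K)) z}"
  define Pc where "Pc = measure_pmf.prob (joint K p) {(x, y, z). pmf (map_pmf fst (K x)) y < Gc * pmf (map_pmf fst (bind_pmf p K)) y}"
  interpret random_code p K S T T1 M L12 L21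
    by unfold_locales fact+
  obtain c f g where fg: "f \<in> UNIV \<rightarrow> {1..L12}" "g \<in> UNIV \<rightarrow> {1..L21}"
    and err: "(\<Sum>w\<in>{1..M}. emeasure (K (c w)) {v. fails w c (f, g) v})
       \<le> of_nat M * (emeasure (joint K p) {v. v \<notin> T} + emeasure (joint K p) {(x, y, z). (x, y) \<notin> T1}
            + of_nat M * confusion)"
    by (rule exists_good_code)
  have conf: "confusion \<le> ennreal (1 / Ga + 1 / (L12 * Gb) + 1 / (L21 * Gc))"
  proof -
    have "confusion \<le> ennreal (1 / Ga) + ennreal (1 / real L12) * ennreal (1 / Gb)
        + ennreal (1 / real L21) * ennreal (1 / Gc)"
      unfolding confusion_def
    proof (intro add_mono mult_left_mono)
      show "emeasure (pair_pmf p (bind_pmf p K)) T \<le> ennreal (1 / Ga)"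
        by (rule order_trans[OF emeasure_mono likelihood_ratio_test[OF assms(6), of p "bind_pmf p K" K]])
          (auto simp: T_def)
      show "(\<Sum>y\<in>S. emeasure (pair_pmf p (map_pmf snd (bind_pmf p K))) {(x, z). (x, y, z) \<in> T})
          \<le> ennreal (1 / Gb)"
        by (rule order_trans[OF sum_mono[OF emeasure_mono]
              likelihood_ratio_test_sum[OF assms(7,1), of p "map_pmf snd (bind_pmf p K)" K]])
          (auto simp: T_def)
      show "emeasure (pair_pmf p (map_pmf fst (bind_pmf p K))) T1 \<le> ennreal (1 / Gc)"
        unfolding T1_def by (rule likelihood_ratio_test[OF assms(8)])
    qed auto
    also have "\<dots> = ennreal (1 / Ga + 1 / (L12 * Gb) + 1 / (L21 * Gc))"
      using assms by (simp add: ennreal_mult[symmetric])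
    finally show ?thesis .
  qed
  have PT: "emeasure (joint K p) {v. v \<notin> T} \<le> ennreal (Pa + Pb)"
  proof -
    have "emeasure (joint K p) {v. v \<notin> T}
        \<le> emeasure (joint K p) ({(x, v). pmf (K x) v < Ga * pmf (bind_pmf p K) v}
            \<union> {(x, y, z). pmf (K x) (y, z) < Gb * pmf (map_pmf snd (bind_pmf p K)) z})"
      by (intro emeasure_mono) (auto simp: T_def)
    also have "\<dots> \<le> emeasure (joint K p) {(x, v). pmf (K x) v < Ga * pmf (bind_pmf p K) v}
        + emeasure (joint K p) {(x, y, z). pmf (K x) (y, z) < Gb * pmf (map_pmf snd (bind_pmf p K)) z}"
      by (intro emeasure_subadditive) auto
    also have "\<dots> = ennreal (Pa + Pb)"
      by (simp add: Pa_def Pb_def measure_pmf.emeasure_eq_measure)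
    finally show ?thesis .
  qed
  have PT1: "emeasure (joint K p) {(x, y, z). (x, y) \<notin> T1} = ennreal Pc"
    by (simp add: Pc_def T1_def measure_pmf.emeasure_eq_measure not_le)
  have nonneg: "0 \<le> Pa" "0 \<le> Pb" "0 \<le> Pc"
    by (simp_all add: Pa_def Pb_def Pc_def)
  let ?e = "1 / Ga + 1 / (L12 * Gb) + 1 / (L21 * Gc)"
  have "0 \<le> ?e"
    using assms by simp
  have "ennreal (\<Sum>w\<in>{1..M}. measure_pmf.prob (K (c w)) {v. fails w c (f, g) v})
      \<le> ennreal M * (ennreal (Pa + Pb) + ennreal Pc + ennreal M * ennreal ?e)"
    using order_trans[OF err mult_left_mono[OF add_mono[OF add_mono[OF PT order_eq_refl[OF PT1]]
            mult_left_mono[OF conf]]]]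
    by (simp add: measure_pmf.emeasure_eq_measure sum_ennreal ennreal_of_nat_eq_real_of_nat)
  also have "\<dots> = ennreal (M * (Pa + Pb + Pc + M * ?e))"
    using nonneg \<open>0 \<le> ?e\<close> by (simp add: ennreal_mult[symmetric] flip: ennreal_plus del: ennreal_plus)
  finally have "(\<Sum>w\<in>{1..M}. measure_pmf.prob (K (c w)) {v. fails w c (f, g) v}) \<le> M * (Pa + Pb + Pc + M * ?e)"
    using nonneg \<open>0 \<le> ?e\<close> by (subst (asm) ennreal_le_iff) (auto intro!: add_nonneg_nonneg mult_nonneg_nonneg)
  then have "(\<Sum>w\<in>{1..M}. measure_pmf.prob (K (c w)) {v. fails w c (f, g) v}) / M
      \<le> Pa + Pb + Pc + (M / Ga + M / (L12 * Gb) + M / (L21 * Gc))"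
    using assms(3) by (simp add: pos_divide_le_eq distrib_left mult.commute)
  then have "(\<Sum>w\<in>{1..M}. measure_pmf.prob (K (c w)) {(y, z). dec_bin T S M c f (f y) z \<noteq> w \<or>
      dec_list T1 M c g (g (dec_bin T S M c f (f y) z)) y \<noteq> w}) / M
      \<le> Pa + Pb + Pc + (M / Ga + M / (L12 * Gb) + M / (L21 * Gc))"
    by (simp only: fails_def prod.case)
  moreover have "dec_bin T S M c f \<in> UNIV \<rightarrow> UNIV \<rightarrow> {1..M}" "dec_list T1 M c g \<in> UNIV \<rightarrow> UNIV \<rightarrow> {1..M}"
    by (intro Pi_I; simp only: dec_bin_def dec_list_def select_in[OF assms(3)])+
  ultimately show ?thesis
    using fg that[of f g "dec_bin T S M c f" "dec_list T1 M c g" c] unfolding Pa_def Pb_def Pc_def by blast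
qed

section \<open>Blocks of a memoryless channel\<close>

text \<open>Hoeffding's inequality: on a finite type \<open>f\<close> is bounded, so falling short
  of the mean by the fixed gap has exponentially small probability.\<close>

lemma weak_law_Pi_pmf:
  fixes P :: "'a::finite pmf" and f :: "'a \<Rightarrow> real"
  assumes t: "t < measure_pmf.expectation P f"
  shows "(\<lambda>n. measure_pmf.prob (Pi_pmf {..<n} d (\<lambda>_. P)) {\<omega>. (\<Sum>i<n. f (\<omega> i)) < real n * t}) \<longlonglongrightarrow> 0"
proof (rule tendsto_sandwich[OF _ _ tendsto_const])
  define e where "e = measure_pmf.expectation P f"
  \<comment> \<open>The added 1 keeps \<open>B\<close> positive even if \<open>f\<close>
    vanishes.\<close>
  define B where "B = (\<Sum>a\<in>UNIV. \<bar>f a\<bar>) + 1"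
  have B: "f a \<in> {-B..B}" for a
    using member_le_sum[of a UNIV "\<lambda>a. \<bar>f a\<bar>"] by (auto simp: B_def abs_le_iff)
  have "0 < B"
    by (simp add: B_def add_nonneg_pos sum_nonneg)
  \<comment> \<open>Hoeffding's exponent for the deviation \<open>n * (e - t)\<close> and
    \<open>n\<close> summands of range \<open>2 * B\<close>, divided by \<open>n\<close>.\<close>
  define c where "c = (e - t)\<^sup>2 / (2 * B\<^sup>2)"
  have "0 < c"
    using t \<open>0 < B\<close> by (simp add: c_def e_def)
  show "\<forall>\<^sub>F n in sequentially. measure_pmf.prob (Pi_pmf {..<n} d (\<lambda>_. P)) {\<omega>. (\<Sum>i<n. f (\<omega> i)) < real n * t}
      \<le> exp (- c * real n)"
  proof (rule eventually_mono[OF eventually_gt_at_top])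
    fix n :: nat assume n: "0 < n"
    let ?P = "Pi_pmf {..<n} d (\<lambda>_. P)"
    have e: "(\<Sum>i<n. measure_pmf.expectation ?P (\<lambda>\<omega>. f (\<omega> i))) = n * e"
    proof -
      have "measure_pmf.expectation ?P (\<lambda>\<omega>. f (\<omega> i)) = e" if "i < n" for i
      proof -
        have "measure_pmf.expectation ?P (\<lambda>\<omega>. f (\<omega> i)) = measure_pmf.expectation (map_pmf (\<lambda>\<omega>. \<omega> i) ?P) f"
          by simp
        then show ?thesis
          using that by (simp add: Pi_pmf_component e_def del: integral_map_pmf)
      qed
      then show ?thesis
        by simp
    qed
    interpret Hoeffding_ineq "measure_pmf ?P" "{..<n}" "\<lambda>i \<omega>. f (\<omega> i)" "\<lambda>_. -B" "\<lambda>_. B" "n * e"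
    proof unfold_locales
      show "prob_space.indep_vars ?P (\<lambda>_. borel) (\<lambda>i \<omega>. f (\<omega> i)) {..<n}"
        by (rule prob_space.indep_vars_compose2[OF measure_pmf.prob_space_axioms indep_vars_Pi_pmf]) auto
    qed (use B e in auto)
    have pos: "(\<Sum>i<n. (B - (- B))\<^sup>2) > 0"
      using n \<open>0 < B\<close> by simp
    have "measure_pmf.prob ?P {\<omega>. (\<Sum>i<n. f (\<omega> i)) < real n * t}
        \<le> measure_pmf.prob ?P {\<omega> \<in> space (measure_pmf ?P). (\<Sum>i<n. f (\<omega> i)) \<le> real n * e - real n * (e - t)}"
      by (intro measure_pmf.finite_measure_mono) (auto simp: algebra_simps)
    also have "\<dots> \<le> exp (-2 * (real n * (e - t))\<^sup>2 / (\<Sum>i<n. (B - (- B))\<^sup>2))"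
      using t pos by (intro Hoeffding_ineq_le mult_nonneg_nonneg) (simp_all add: e_def less_imp_le)
    also have "-2 * (real n * (e - t))\<^sup>2 / (\<Sum>i<n. (B - (- B))\<^sup>2) = - c * real n"
      using n \<open>0 < B\<close> by (simp add: c_def field_simps power2_eq_square)
    finally show "measure_pmf.prob ?P {\<omega>. (\<Sum>i<n. f (\<omega> i)) < real n * t} \<le> exp (- c * real n)" .
  qed
  show "(\<lambda>n. exp (- c * real n)) \<longlonglongrightarrow> 0"
    using \<open>0 < c\<close> by real_asymp
qed simp

text \<open>Logarithms turn the product test into a test on a sum of independent terms; this is
  legitimate almost surely because \<open>u\<close> and \<open>v\<close> are positive on the
  support.\<close>

lemma likelihood_ratio_Pi_pmf:
  fixes P :: "'a::finite pmf" and u v :: "'a \<Rightarrow> real"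
  assumes pos: "\<And>a. a \<in> set_pmf P \<Longrightarrow> 0 < u a" "\<And>a. a \<in> set_pmf P \<Longrightarrow> 0 < v a"
    and t: "t < measure_pmf.expectation P (\<lambda>a. log 2 (u a / v a))"
  shows "(\<lambda>n. measure_pmf.prob (Pi_pmf {..<n} d (\<lambda>_. P))
      {\<omega>. (\<Prod>i<n. u (\<omega> i)) < 2 powr (real n * t) * (\<Prod>i<n. v (\<omega> i))}) \<longlonglongrightarrow> 0"
proof -
  have "measure_pmf.prob (Pi_pmf {..<n} d (\<lambda>_. P)) {\<omega>. (\<Prod>i<n. u (\<omega> i)) < 2 powr (n * t) * (\<Prod>i<n. v (\<omega> i))}
      = measure_pmf.prob (Pi_pmf {..<n} d (\<lambda>_. P)) {\<omega>. (\<Sum>i<n. log 2 (u (\<omega> i) / v (\<omega> i))) < n * t}" for n :: nat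
  proof (rule measure_pmf.finite_measure_eq_AE; (intro AE_pmfI)?)
    fix \<omega> assume "\<omega> \<in> set_pmf (Pi_pmf {..<n} d (\<lambda>_. P))"
    then have "\<omega> i \<in> set_pmf P" if "i < n" for i
      using that by (simp add: set_Pi_pmf PiE_dflt_def)
    then have pos': "0 < u (\<omega> i)" "0 < v (\<omega> i)" if "i < n" for i
      using that pos by auto
    then have ne: "u (\<omega> i) \<noteq> 0" "v (\<omega> i) \<noteq> 0" if "i < n" for i
      using that by (simp_all add: less_imp_neq[symmetric])
    from pos' have pu: "0 < (\<Prod>i<n. u (\<omega> i))" and pv: "0 < (\<Prod>i<n. v (\<omega> i))"
      by (auto intro: prod_pos)
    have "(\<Sum>i<n. log 2 (u (\<omega> i) / v (\<omega> i))) = log 2 ((\<Prod>i<n. u (\<omega> i)) / (\<Prod>i<n. v (\<omega> i)))"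
      unfolding prod_dividef[symmetric] log_def
      using ne by (subst ln_prod) (auto simp: sum_divide_distrib)
    also have "\<dots> < n * t \<longleftrightarrow> (\<Prod>i<n. u (\<omega> i)) / (\<Prod>i<n. v (\<omega> i)) < 2 powr (n * t)"
      using pu pv by (subst log_less_iff) auto
    also have "\<dots> \<longleftrightarrow> (\<Prod>i<n. u (\<omega> i)) < 2 powr (n * t) * (\<Prod>i<n. v (\<omega> i))"
      using pv by (simp add: pos_divide_less_eq)
    finally show "(\<omega> \<in> {\<omega>. (\<Prod>i<n. u (\<omega> i)) < 2 powr (n * t) * (\<Prod>i<n. v (\<omega> i))}) =
        (\<omega> \<in> {\<omega>. (\<Sum>i<n. log 2 (u (\<omega> i) / v (\<omega> i))) < n * t})"
      by simp
  qed auto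
  then show ?thesis
    using weak_law_Pi_pmf[OF t] by simp
qed

section \<open>Blocks as single symbols\<close>

text \<open>Gives a block of output pairs the shape of a pair of outputs, as
  \<open>one_shot_code\<close> expects.\<close>

definition unzip :: "(nat \<Rightarrow> 'y \<times> 'z) \<Rightarrow> (nat \<Rightarrow> 'y) \<times> (nat \<Rightarrow> 'z)" where
  "unzip v = (fst \<circ> v, snd \<circ> v)"

lemma inj_unzip: "inj unzip"
  by (auto simp: inj_on_def unzip_def fun_eq_iff prod_eq_iff)

definition block_input :: "'x pmf \<Rightarrow> nat \<Rightarrow> (nat \<Rightarrow> 'x) pmf" where
  "block_input p n = Pi_pmf {..<n} undefined (\<lambda>_. p)"

definition block_kernel ::
    "'y \<times> 'z \<Rightarrow> ('x \<Rightarrow> ('y \<times> 'z) pmf) \<Rightarrow> nat \<Rightarrow> (nat \<Rightarrow> 'x) \<Rightarrow> ((nat \<Rightarrow> 'y) \<times> (nat \<Rightarrow> 'z)) pmf" where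
  "block_kernel d Q n xs = map_pmf unzip (Pi_pmf {..<n} d (\<lambda>i. Q (xs i)))"

lemma bind_block_kernel:
  "bind_pmf (block_input p n) (block_kernel d Q n) = map_pmf unzip (Pi_pmf {..<n} d (\<lambda>_. bind_pmf p Q))"
  by (simp add: block_input_def block_kernel_def[abs_def] Pi_pmf_bind[where d' = undefined] map_bind_pmf)

text \<open>Independent inputs and a memoryless channel make the block of triples independent and
  identically distributed, which is what the law of large numbers needs.\<close>

lemma joint_block_kernel:
  "joint (block_kernel d Q n) (block_input p n)
     = map_pmf (\<lambda>\<omega>. (fst \<circ> \<omega>, unzip (snd \<circ> \<omega>))) (Pi_pmf {..<n} (undefined, d) (\<lambda>_. joint Q p))"
proof -
  have "Pi_pmf {..<n} (undefined, d) (\<lambda>_. joint Q p)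
      = bind_pmf (block_input p n) (\<lambda>xs. Pi_pmf {..<n} (undefined, d) (\<lambda>i. map_pmf (Pair (xs i)) (Q (xs i))))"
    by (simp add: joint_def block_input_def Pi_pmf_bind[where d' = undefined])
  also have "\<dots> = bind_pmf (block_input p n) (\<lambda>xs. map_pmf (\<lambda>v i. (xs i, v i)) (Pi_pmf {..<n} d (\<lambda>i. Q (xs i))))"
  proof (rule bind_pmf_cong[OF refl])
    fix xs assume "xs \<in> set_pmf (block_input p n)"
    \<comment> \<open>On the support the input is \<open>undefined\<close> outside the block, so
      coordinatewise pairing reproduces the default \<open>(undefined, d)\<close> exactly.\<close>
    then have xs: "xs i = undefined" if "\<not> i < n" for i
      using that by (auto simp: block_input_def set_Pi_pmf PiE_dflt_def)
    have "Pi_pmf {..<n} (undefined, d) (\<lambda>i. map_pmf (Pair (xs i)) (Q (xs i)))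
        = bind_pmf (Pi_pmf {..<n} d (\<lambda>i. Q (xs i)))
            (\<lambda>v. return_pmf (\<lambda>i. if i \<in> {..<n} then (xs i, v i) else (undefined, d)))"
      by (simp add: map_pmf_def Pi_pmf_bind[where d' = d])
    also have "\<dots> = bind_pmf (Pi_pmf {..<n} d (\<lambda>i. Q (xs i))) (\<lambda>v. return_pmf (\<lambda>i. (xs i, v i)))"
      using xs by (intro bind_pmf_cong refl arg_cong[where f = return_pmf])
        (auto simp: set_Pi_pmf PiE_dflt_def fun_eq_iff)
    finally show "Pi_pmf {..<n} (undefined, d) (\<lambda>i. map_pmf (Pair (xs i)) (Q (xs i)))
        = map_pmf (\<lambda>v i. (xs i, v i)) (Pi_pmf {..<n} d (\<lambda>i. Q (xs i)))"
      by (simp add: map_pmf_def)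
  qed
  finally show ?thesis
    by (simp add: joint_def block_kernel_def map_bind_pmf pmf.map_comp o_def)
qed

text \<open>Projections and averaging over independent inputs keep the product form. The product
  formula is for points with the default value outside the index set, hence the assumption on
  \<open>v\<close>.\<close>

lemma pmf_block:
  assumes "\<And>i. \<not> i < n \<Longrightarrow> v i = d"
  shows "pmf (block_kernel d Q n xs) (unzip v) = (\<Prod>i<n. pmf (Q (xs i)) (v i))"
    and "pmf (map_pmf fst (block_kernel d Q n xs)) (fst \<circ> v) = (\<Prod>i<n. pmf (map_pmf fst (Q (xs i))) (fst (v i)))"
    and "pmf (bind_pmf (block_input p n) (block_kernel d Q n)) (unzip v) = (\<Prod>i<n. pmf (bind_pmf p Q) (v i))"
    and "pmf (map_pmf fst (bind_pmf (block_input p n) (block_kernel d Q n))) (fst \<circ> v)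
      = (\<Prod>i<n. pmf (map_pmf fst (bind_pmf p Q)) (fst (v i)))"
    and "pmf (map_pmf snd (bind_pmf (block_input p n) (block_kernel d Q n))) (snd \<circ> v)
      = (\<Prod>i<n. pmf (map_pmf snd (bind_pmf p Q)) (snd (v i)))"
proof -
  show "pmf (block_kernel d Q n xs) (unzip v) = (\<Prod>i<n. pmf (Q (xs i)) (v i))"
    unfolding block_kernel_def pmf_map_inj'[OF inj_unzip] using assms by (intro pmf_Pi') auto
  show "pmf (bind_pmf (block_input p n) (block_kernel d Q n)) (unzip v) = (\<Prod>i<n. pmf (bind_pmf p Q) (v i))"
    unfolding bind_block_kernel pmf_map_inj'[OF inj_unzip] using assms by (intro pmf_Pi') auto
  have fst: "map_pmf fst (map_pmf unzip (Pi_pmf {..<n} d q)) = Pi_pmf {..<n} (fst d) (\<lambda>i. map_pmf fst (q i))"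
    and snd: "map_pmf snd (map_pmf unzip (Pi_pmf {..<n} d q)) = Pi_pmf {..<n} (snd d) (\<lambda>i. map_pmf snd (q i))"
    for q
    by (simp_all add: Pi_pmf_map[where dflt = d] pmf.map_comp o_def unzip_def)
  show "pmf (map_pmf fst (block_kernel d Q n xs)) (fst \<circ> v) = (\<Prod>i<n. pmf (map_pmf fst (Q (xs i))) (fst (v i)))"
    unfolding block_kernel_def fst using assms by (subst pmf_Pi') auto
  show "pmf (map_pmf fst (bind_pmf (block_input p n) (block_kernel d Q n))) (fst \<circ> v)
      = (\<Prod>i<n. pmf (map_pmf fst (bind_pmf p Q)) (fst (v i)))"
    unfolding bind_block_kernel fst using assms by (subst pmf_Pi') auto
  show "pmf (map_pmf snd (bind_pmf (block_input p n) (block_kernel d Q n))) (snd \<circ> v)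
      = (\<Prod>i<n. pmf (map_pmf snd (bind_pmf p Q)) (snd (v i)))"
    unfolding bind_block_kernel snd using assms by (subst pmf_Pi') auto
qed

text \<open>The events need to agree only on blocks with default values outside
  \<open>{..<n}\<close>, which has probability one.\<close>

lemma prob_joint_block:
  assumes "\<And>\<omega>. (\<And>i. \<not> i < n \<Longrightarrow> \<omega> i = (undefined, d)) \<Longrightarrow>
      (fst \<circ> \<omega>, unzip (snd \<circ> \<omega>)) \<in> A \<longleftrightarrow> \<omega> \<in> B"
  shows "measure_pmf.prob (joint (block_kernel d Q n) (block_input p n)) A
      = measure_pmf.prob (Pi_pmf {..<n} (undefined, d) (\<lambda>_. joint Q p)) B"
  unfolding joint_block_kernel measure_map_pmf
  using assms by (intro measure_pmf.finite_measure_eq_AE AE_pmfI) (auto simp: set_Pi_pmf PiE_dflt_def)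

text \<open>By the product formulas each rejection event of \<open>one_shot_code\<close> is a
  product test on independent triples, and an exponent \<open>t\<close> below the mean density makes
  it improbable.\<close>

lemma
  fixes Q :: "'x::finite \<Rightarrow> ('y::finite \<times> 'z::finite) pmf"
  shows density_12_block: "t < measure_pmf.expectation (joint Q p) (density_12 Q p) \<Longrightarrow>
      (\<lambda>n. measure_pmf.prob (joint (block_kernel d Q n) (block_input p n))
        {(x, v). pmf (block_kernel d Q n x) v
          < 2 powr (real n * t) * pmf (bind_pmf (block_input p n) (block_kernel d Q n)) v}) \<longlonglongrightarrow> 0"
    and density_bin_block: "t < measure_pmf.expectation (joint Q p) (density_bin Q p) \<Longrightarrow>
      (\<lambda>n. measure_pmf.prob (joint (block_kernel d Q n) (block_input p n))
        {(x, y, z). pmf (block_kernel d Q n x) (y, z)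
          < 2 powr (real n * t) * pmf (map_pmf snd (bind_pmf (block_input p n) (block_kernel d Q n))) z}) \<longlonglongrightarrow> 0"
    and density_1_block: "t < measure_pmf.expectation (joint Q p) (density_1 Q p) \<Longrightarrow>
      (\<lambda>n. measure_pmf.prob (joint (block_kernel d Q n) (block_input p n))
        {(x, y, z). pmf (map_pmf fst (block_kernel d Q n x)) y
          < 2 powr (real n * t) * pmf (map_pmf fst (bind_pmf (block_input p n) (block_kernel d Q n))) y}) \<longlonglongrightarrow> 0"
proof -
  note pos = set_joint_pos
  assume t: "t < measure_pmf.expectation (joint Q p) (density_12 Q p)"
  have eq: "measure_pmf.prob (joint (block_kernel d Q n) (block_input p n))
        {(x, v). pmf (block_kernel d Q n x) v
          < 2 powr (real n * t) * pmf (bind_pmf (block_input p n) (block_kernel d Q n)) v}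
      = measure_pmf.prob (Pi_pmf {..<n} (undefined, d) (\<lambda>_. joint Q p))
        {\<omega>. (\<Prod>i<n. pmf (Q (fst (\<omega> i))) (snd (\<omega> i))) < 2 powr (real n * t) * (\<Prod>i<n. pmf (bind_pmf p Q) (snd (\<omega> i)))}" for n
    by (rule prob_joint_block) (simp add: pmf_block)
  show "(\<lambda>n. measure_pmf.prob (joint (block_kernel d Q n) (block_input p n))
        {(x, v). pmf (block_kernel d Q n x) v
          < 2 powr (real n * t) * pmf (bind_pmf (block_input p n) (block_kernel d Q n)) v}) \<longlonglongrightarrow> 0"
    unfolding eq using t by (intro likelihood_ratio_Pi_pmf) (auto simp: density_12_def split_def dest: pos)
next
  note pos = set_joint_pos
  assume t: "t < measure_pmf.expectation (joint Q p) (density_bin Q p)"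
  have eq: "measure_pmf.prob (joint (block_kernel d Q n) (block_input p n))
        {(x, y, z). pmf (block_kernel d Q n x) (y, z)
          < 2 powr (real n * t) * pmf (map_pmf snd (bind_pmf (block_input p n) (block_kernel d Q n))) z}
      = measure_pmf.prob (Pi_pmf {..<n} (undefined, d) (\<lambda>_. joint Q p))
        {\<omega>. (\<Prod>i<n. pmf (Q (fst (\<omega> i))) (snd (\<omega> i)))
          < 2 powr (real n * t) * (\<Prod>i<n. pmf (map_pmf snd (bind_pmf p Q)) (snd (snd (\<omega> i))))}" for n
    by (rule prob_joint_block) (simp add: pmf_block pmf_block(1,5)[unfolded unzip_def] unzip_def)
  show "(\<lambda>n. measure_pmf.prob (joint (block_kernel d Q n) (block_input p n))
        {(x, y, z). pmf (block_kernel d Q n x) (y, z)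
          < 2 powr (real n * t) * pmf (map_pmf snd (bind_pmf (block_input p n) (block_kernel d Q n))) z}) \<longlonglongrightarrow> 0"
    unfolding eq using t by (intro likelihood_ratio_Pi_pmf) (auto simp: density_bin_def split_def dest: pos)
next
  note pos = set_joint_pos
  assume t: "t < measure_pmf.expectation (joint Q p) (density_1 Q p)"
  have eq: "measure_pmf.prob (joint (block_kernel d Q n) (block_input p n))
        {(x, y, z). pmf (map_pmf fst (block_kernel d Q n x)) y
          < 2 powr (real n * t) * pmf (map_pmf fst (bind_pmf (block_input p n) (block_kernel d Q n))) y}
      = measure_pmf.prob (Pi_pmf {..<n} (undefined, d) (\<lambda>_. joint Q p))
        {\<omega>. (\<Prod>i<n. pmf (map_pmf fst (Q (fst (\<omega> i)))) (fst (snd (\<omega> i))))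
          < 2 powr (real n * t) * (\<Prod>i<n. pmf (map_pmf fst (bind_pmf p Q)) (fst (snd (\<omega> i))))}" for n
    by (rule prob_joint_block) (simp add: pmf_block(2,4) unzip_def)
  show "(\<lambda>n. measure_pmf.prob (joint (block_kernel d Q n) (block_input p n))
        {(x, y, z). pmf (map_pmf fst (block_kernel d Q n x)) y
          < 2 powr (real n * t) * pmf (map_pmf fst (bind_pmf (block_input p n) (block_kernel d Q n))) y}) \<longlonglongrightarrow> 0"
    unfolding eq using t by (intro likelihood_ratio_Pi_pmf) (auto simp: density_1_def split_def dest: pos)
qed

section \<open>Codes for the broadcast channel\<close>

text \<open>The default \<open>d\<close> is arbitrary instead of \<open>undefined\<close>, because exchanging the receivers turns
  \<open>undefined\<close> into \<open>prod.swap undefined\<close>.\<close>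

definition block_error :: "'y \<times> 'z \<Rightarrow> ('x \<Rightarrow> ('y \<times> 'z) pmf) \<Rightarrow> nat \<Rightarrow> real \<Rightarrow> ('x, 'y, 'z) bc_code \<Rightarrow> real" where
  "block_error d Q n r c =
     (\<Sum>w\<in>message_set n r. measure_pmf.prob (Pi_pmf {..<n} d (\<lambda>i. Q (encoder c w i)))
        {v. decoding_error c w (fst \<circ> v) (snd \<circ> v)}) / card (message_set n r)"

section \<open>Rounding, error probability and codes of a given rate\<close>

text \<open>Rounding a number \<ge> 1 down loses at most a factor 2, which the exponential gaps
  absorb.\<close>

lemma message_set_bounds:
  fixes n :: nat
  assumes "0 \<le> r"
  shows "1 \<le> nat \<lfloor>2 powr (real n * r)\<rfloor>" "real (nat \<lfloor>2 powr (real n * r)\<rfloor>) \<le> 2 powr (real n * r)"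
    "2 powr (real n * r) / 2 \<le> real (nat \<lfloor>2 powr (real n * r)\<rfloor>)"
proof -
  have ge: "1 \<le> 2 powr (real n * r)"
    using assms by (simp add: ge_one_powr_ge_zero)
  then show 1: "1 \<le> nat \<lfloor>2 powr (real n * r)\<rfloor>"
    by (simp add: le_nat_iff le_floor_iff)
  show "real (nat \<lfloor>2 powr (real n * r)\<rfloor>) \<le> 2 powr (real n * r)"
    by (simp add: of_nat_floor)
  have "2 powr (real n * r) < real (nat \<lfloor>2 powr (real n * r)\<rfloor>) + 1"
    using ge by linarith
  then show "2 powr (real n * r) / 2 \<le> real (nat \<lfloor>2 powr (real n * r)\<rfloor>)"
    using 1 by linarith
qed

text \<open>A nonnegative rate makes the message set nonempty, so the uniform message expands into
  an average.\<close>

lemma error_prob_eq_block_error: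
  assumes "0 \<le> r"
  shows "error_prob Q n r c = block_error undefined Q n r c"
proof -
  let ?M = "message_set n r"
  have ne: "?M \<noteq> {}" "finite ?M"
    using message_set_bounds(1)[OF assms, of n] by (simp_all add: message_set_def)
  have "ennreal (error_prob Q n r c)
      = (\<Sum>w\<in>?M. ennreal (measure_pmf.prob (dmc Q n (encoder c w)) {v. decoding_error c w (fst \<circ> v) (snd \<circ> v)})) / card ?M"
    unfolding error_prob_def measure_pmf.emeasure_eq_measure[symmetric]
    using ne by (simp add: nn_integral_pmf_of_set vimage_def)
  also have "\<dots> = ennreal (block_error undefined Q n r c)"
    using ne by (simp add: block_error_def dmc_def sum_ennreal divide_ennreal card_gt_0_iff sum_nonneg
        ennreal_of_nat_eq_real_of_nat)
  finally show ?thesis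
    by (subst (asm) ennreal_inj) (auto simp: error_prob_def block_error_def intro!: divide_nonneg_nonneg sum_nonneg)
qed

lemma block_error_nonneg: "0 \<le> block_error d Q n r c"
  by (auto simp: block_error_def intro!: divide_nonneg_nonneg sum_nonneg)

text \<open>The one-shot bound for blocks, with hashes filling both links and thresholds exponential
  in \<open>n\<close>.\<close>

lemma block_codes:
  fixes Q :: "'x::finite \<Rightarrow> ('y::finite \<times> 'z::finite) pmf"
  assumes C: "0 \<le> C12" "0 \<le> C21" and R: "0 \<le> R" "R < rate12 Q C12 C21 p"
  shows "\<exists>c :: nat \<Rightarrow> ('x, 'y, 'z) bc_code. (\<forall>n. is_code n R C12 C21 (c n)) \<and>
           (\<lambda>n. block_error d Q n R (c n)) \<longlonglongrightarrow> 0"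
proof -
  define Ia where "Ia = measure_pmf.expectation (joint Q p) (density_12 Q p)"
  define Ib where "Ib = measure_pmf.expectation (joint Q p) (density_bin Q p)"
  define Ic where "Ic = measure_pmf.expectation (joint Q p) (density_1 Q p)"
  \<comment> \<open>The inner minimum in \<open>rate12\<close> yields the first two inequalities,
    the outer minimum the third. Each strict gap leaves room for a threshold exponent.\<close>
  have "R < Ia" "R - C12 < Ib" "R - C21 < Ic"
    using R(2) unfolding rate12_def Let_def Ia_def Ib_def Ic_def expectation_density_1
      expectation_density_bin expectation_density_12
    by (auto simp: min_def split: if_splits)
  then obtain ta tb tc where t: "R < ta" "ta < Ia" "R - C12 < tb" "tb < Ib" "R - C21 < tc" "tc < Ic"
    using dense[of R Ia] dense[of "R - C12" Ib] dense[of "R - C21" Ic] by blast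
  let ?K = "block_kernel d Q" and ?p = "block_input p"
  let ?M = "\<lambda>n. nat \<lfloor>2 powr (real n * R)\<rfloor>"
  let ?L12 = "\<lambda>n. nat \<lfloor>2 powr (real n * C12)\<rfloor>"
  let ?L21 = "\<lambda>n. nat \<lfloor>2 powr (real n * C21)\<rfloor>"
  define Pa where "Pa n = measure_pmf.prob (joint (?K n) (?p n))
      {(x, v). pmf (?K n x) v < 2 powr (real n * ta) * pmf (bind_pmf (?p n) (?K n)) v}" for n
  define Pb where "Pb n = measure_pmf.prob (joint (?K n) (?p n))
      {(x, y, z). pmf (?K n x) (y, z) < 2 powr (real n * tb) * pmf (map_pmf snd (bind_pmf (?p n) (?K n))) z}" for n
  define Pc where "Pc n = measure_pmf.prob (joint (?K n) (?p n))
      {(x, y, z). pmf (map_pmf fst (?K n x)) y < 2 powr (real n * tc) * pmf (map_pmf fst (bind_pmf (?p n) (?K n))) y}" for n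
  \<comment> \<open>The powers dominate the confusion terms; the factors 2 pay for rounding
    \<open>L12\<close> and \<open>L21\<close> down.\<close>
  define bound where "bound n = Pa n + Pb n + Pc n +
      (2 powr (real n * (R - ta)) + 2 * 2 powr (real n * (R - C12 - tb)) + 2 * 2 powr (real n * (R - C21 - tc)))" for n
  have "\<exists>c :: ('x, 'y, 'z) bc_code. is_code n R C12 C21 c \<and> block_error d Q n R c \<le> bound n" for n
  proof -
    define S where "S = PiE_dflt {..<n} (fst d) (\<lambda>_. UNIV :: 'y set)"
    have "finite S"
      by (simp add: S_def finite_PiE_dflt)
    have sub: "fst ` set_pmf (?K n x) \<subseteq> S" for x
      by (auto simp: block_kernel_def unzip_def S_def set_Pi_pmf PiE_dflt_def)
    note ms = message_set_bounds[where n = n]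
    obtain c f g d2 d1 where fg: "f \<in> UNIV \<rightarrow> {1..?L12 n}" "g \<in> UNIV \<rightarrow> {1..?L21 n}"
      and dec: "d2 \<in> UNIV \<rightarrow> UNIV \<rightarrow> {1..?M n}" "d1 \<in> UNIV \<rightarrow> UNIV \<rightarrow> {1..?M n}"
      and err: "(\<Sum>w\<in>{1..?M n}. measure_pmf.prob (?K n (c w))
            {(y, z). d2 (f y) z \<noteq> w \<or> d1 (g (d2 (f y) z)) y \<noteq> w}) / ?M n
         \<le> Pa n + Pb n + Pc n + (?M n / 2 powr (real n * ta) + ?M n / (?L12 n * 2 powr (real n * tb))
            + ?M n / (?L21 n * 2 powr (real n * tc)))"
      unfolding Pa_def Pb_def Pc_def
      by (rule one_shot_code[OF \<open>finite S\<close> sub ms(1)[OF R(1)] ms(1)[OF C(1)] ms(1)[OF C(2)],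
            where Ga = "2 powr (real n * ta)" and Gb = "2 powr (real n * tb)" and Gc = "2 powr (real n * tc)"
              and p = "?p n"]) simp_all
    \<comment> \<open>Receiver 2 answers with the hash of its own decision, recomputed from the
      announced bin \<open>h\<close>.\<close>
    define code :: "('x, 'y, 'z) bc_code" where
      "code = \<lparr>encoder = c, conf = First1 f (\<lambda>z h. g (d2 h z)), decoder1 = d1, decoder2 = d2\<rparr>"
    have "is_code n R C12 C21 code"
      using fg dec by (auto simp: is_code_def code_def message_set_def Pi_iff)
    have err_iff: "decoding_error code w y z \<longleftrightarrow> d2 (f y) z \<noteq> w \<or> d1 (g (d2 (f y) z)) y \<noteq> w" for w y z
      by (auto simp: decoding_error_def code_def)
    have enc: "encoder code = c"
      by (simp add: code_def)
    have "block_error d Q n R code = (\<Sum>w\<in>{1..?M n}. measure_pmf.prob (?K n (c w))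
            {(y, z). d2 (f y) z \<noteq> w \<or> d1 (g (d2 (f y) z)) y \<noteq> w}) / ?M n"
      by (simp add: block_error_def message_set_def err_iff enc block_kernel_def unzip_def vimage_def)
    also note err
    also have "Pa n + Pb n + Pc n + (?M n / 2 powr (real n * ta) + ?M n / (?L12 n * 2 powr (real n * tb))
            + ?M n / (?L21 n * 2 powr (real n * tc))) \<le> bound n"
      unfolding bound_def
    proof (intro add_mono order_refl)
      show "?M n / 2 powr (real n * ta) \<le> 2 powr (real n * (R - ta))"
        using ms(2)[OF R(1)] by (simp add: right_diff_distrib powr_diff divide_right_mono)
      have *: "?M n / (L * 2 powr (real n * t)) \<le> 2 * 2 powr (real n * (R - C - t))"
        if "2 powr (real n * C) / 2 \<le> L" for C t L :: real
      proof -
        have "?M n / (L * 2 powr (real n * t)) \<le> 2 powr (real n * R) / (2 powr (real n * C) / 2 * 2 powr (real n * t))"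
          using that ms(2)[OF R(1)] by (intro frac_le mult_right_mono) auto
        then show ?thesis
          by (simp add: right_diff_distrib powr_diff mult.commute)
      qed
      show "?M n / (?L12 n * 2 powr (real n * tb)) \<le> 2 * 2 powr (real n * (R - C12 - tb))"
        by (intro * ms(3) C)
      show "?M n / (?L21 n * 2 powr (real n * tc)) \<le> 2 * 2 powr (real n * (R - C21 - tc))"
        by (intro * ms(3) C)
    qed
    finally show ?thesis
      using \<open>is_code n R C12 C21 code\<close> by blast
  qed
  then have "\<exists>c :: nat \<Rightarrow> ('x, 'y, 'z) bc_code. \<forall>n. is_code n R C12 C21 (c n) \<and> block_error d Q n R (c n) \<le> bound n"
    by (intro choice allI)
  then obtain c :: "nat \<Rightarrow> ('x, 'y, 'z) bc_code" where
    c: "\<And>n. is_code n R C12 C21 (c n)" "\<And>n. block_error d Q n R (c n) \<le> bound n"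
    by blast
  have powr: "(\<lambda>n. 2 powr (real n * s)) \<longlonglongrightarrow> 0" if "s < 0" for s
  proof -
    have "2 powr s < 1"
      using powr_less_mono[OF that, of 2] by simp
    then have "(\<lambda>n. (2 powr s) ^ n) \<longlonglongrightarrow> 0"
      by (intro LIMSEQ_power_zero) simp
    then show ?thesis
      by (simp add: powr_realpow[symmetric] powr_powr mult.commute)
  qed
  have bound: "bound \<longlonglongrightarrow> 0 + 0 + 0 + (0 + 2 * 0 + 2 * 0)"
    unfolding bound_def Pa_def Pb_def Pc_def using t
    by (intro tendsto_add tendsto_mult tendsto_const powr density_12_block density_bin_block density_1_block)
      (simp_all add: Ia_def Ib_def Ic_def)
  have "(\<lambda>n. block_error d Q n R (c n)) \<longlonglongrightarrow> 0"
  proof (rule tendsto_sandwich[OF _ _ tendsto_const])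
    show "bound \<longlonglongrightarrow> 0"
      using bound by simp
  qed (use c(2) in \<open>auto simp: block_error_nonneg\<close>)
  with c(1) show ?thesis
    by blast
qed

section \<open>Exchanging the receivers\<close>

definition swap_channel :: "('x \<Rightarrow> ('y \<times> 'z) pmf) \<Rightarrow> 'x \<Rightarrow> ('z \<times> 'y) pmf" where
  "swap_channel Q x = map_pmf prod.swap (Q x)"

fun swap_conf :: "('y, 'z) conference \<Rightarrow> ('z, 'y) conference" where
  "swap_conf (First1 h12 h21) = First2 h12 h21"
| "swap_conf (First2 h21 h12) = First1 h21 h12"

definition swap_code :: "('x, 'y, 'z) bc_code \<Rightarrow> ('x, 'z, 'y) bc_code" where
  "swap_code c = \<lparr>encoder = encoder c, conf = swap_conf (conf c), decoder1 = decoder2 c, decoder2 = decoder1 c\<rparr>"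

lemma is_code_swap: "is_code n r R12 R21 c \<Longrightarrow> is_code n r R21 R12 (swap_code c)"
  by (cases "conf c") (auto simp: is_code_def swap_code_def)

lemma decoding_error_swap: "decoding_error (swap_code c) w ys zs \<longleftrightarrow> decoding_error c w zs ys"
  by (cases "conf c") (auto simp: decoding_error_def swap_code_def)

lemma block_error_swap:
  "block_error (prod.swap d) Q n r (swap_code c) = block_error d (swap_channel Q) n r c"
proof -
  have "Pi_pmf {..<n} d (\<lambda>i. swap_channel Q (xs i))
      = map_pmf (\<lambda>v. prod.swap \<circ> v) (Pi_pmf {..<n} (prod.swap d) (\<lambda>i. Q (xs i)))" for xs
    unfolding swap_channel_def by (intro Pi_pmf_map) auto
  moreover have swap: "fst \<circ> (prod.swap \<circ> v) = snd \<circ> v" "snd \<circ> (prod.swap \<circ> v) = fst \<circ> v" for v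
    by auto
  ultimately show ?thesis
    by (simp add: block_error_def decoding_error_swap vimage_def swap) (simp add: swap_code_def)
qed

text \<open>Reduces the conference started by receiver 2 to the one started by receiver 1: the
  information quantities depend only on the joint law, whose outputs are exchanged.\<close>

lemma rate21_eq_rate12_swap:
  fixes Q :: "'x::finite \<Rightarrow> ('y::finite \<times> 'z::finite) pmf"
  shows "rate21 Q C12 C21 p = rate12 (swap_channel Q) C21 C12 p"
proof -
  have joint: "joint (swap_channel Q) p = map_pmf (\<lambda>(x, y, z). (x, z, y)) (joint Q p)"
    by (simp add: joint_def swap_channel_def map_bind_pmf pmf.map_comp o_def prod.swap_def split_def)
  have sel: "inX \<circ> (\<lambda>(x, y, z). (x, z, y)) = inX" "outY1 \<circ> (\<lambda>(x, y, z). (x, z, y)) = outY2"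
    "outY2 \<circ> (\<lambda>(x, y, z). (x, z, y)) = outY1"
    "(\<lambda>\<omega>. (outY2 \<omega>, inX \<omega>)) \<circ> (\<lambda>(x, y, z). (x, z, y)) = (\<lambda>\<omega>. (outY1 \<omega>, inX \<omega>))"
    by (auto simp: inX_def outY1_def outY2_def fun_eq_iff)
  show ?thesis
    unfolding rate12_def rate21_def Let_def joint mutual_info_map_pmf cond_entropy_map_pmf sel ..
qed

lemma codes_below_rate_bound:
  fixes Q :: "'x::finite \<Rightarrow> ('y::finite \<times> 'z::finite) pmf"
  assumes C: "0 \<le> C12" "0 \<le> C21" and R: "0 \<le> R" "ereal R < rate_bound Q C12 C21"
  shows "\<exists>c :: nat \<Rightarrow> ('x, 'y, 'z) bc_code. (\<forall>n. is_code n R C12 C21 (c n)) \<and>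
           (\<lambda>n. error_prob Q n R (c n)) \<longlonglongrightarrow> 0"
proof -
  \<comment> \<open>Since \<open>R\<close> lies strictly below the supremum, a single input
    distribution already exceeds it.\<close>
  obtain p where "R < rate12 Q C12 C21 p \<or> R < rate21 Q C12 C21 p"
    using R(2) by (auto simp: rate_bound_def less_SUP_iff less_max_iff_disj split: if_splits)
  then show ?thesis
  proof
    assume "R < rate12 Q C12 C21 p"
    from block_codes[OF C R(1) this] show ?thesis
      by (simp add: error_prob_eq_block_error[OF R(1)])
  next
    assume "R < rate21 Q C12 C21 p"
    then have "R < rate12 (swap_channel Q) C21 C12 p"
      by (simp add: rate21_eq_rate12_swap)
    \<comment> \<open>Swapping back turns the default \<open>prod.swap undefined\<close> into
      \<open>undefined\<close>, the one used by \<open>error_prob\<close>.\<close>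
    from block_codes[OF C(2,1) R(1) this, of "prod.swap undefined"]
    obtain c :: "nat \<Rightarrow> ('x, 'z, 'y) bc_code" where c: "\<And>n. is_code n R C21 C12 (c n)"
      "(\<lambda>n. block_error (prod.swap undefined) (swap_channel Q) n R (c n)) \<longlonglongrightarrow> 0"
      by blast
    have "error_prob Q n R (swap_code (c n)) = block_error (prod.swap undefined) (swap_channel Q) n R (c n)" for n
      using block_error_swap[of "prod.swap undefined" Q n R "c n"]
      by (simp add: error_prob_eq_block_error[OF R(1)])
    with c show ?thesis
      by (intro exI[of _ "\<lambda>n. swap_code (c n)"]) (simp add: is_code_swap)
  qed
qed

section \<open>Reaching the boundary rate\<close>

text \<open>At time \<open>n\<close> the largest index up to \<open>n\<close> is used whose errors
  stay below \<open>1 / Suc k\<close> from \<open>n\<close> on. Every index qualifies eventually, so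
  the chosen ones tend to infinity.\<close>

lemma tendsto_diagonal:
  fixes e :: "nat \<Rightarrow> nat \<Rightarrow> real"
  assumes lim: "\<And>k. e k \<longlonglongrightarrow> 0" and nonneg: "\<And>k n. 0 \<le> e k n"
  obtains k :: "nat \<Rightarrow> nat" where "filterlim k at_top sequentially" "(\<lambda>n. e (k n) n) \<longlonglongrightarrow> 0"
proof -
  let ?G = "\<lambda>n. {k. k \<le> n \<and> (k = 0 \<or> (\<forall>m\<ge>n. e k m \<le> 1 / Suc k))}"
  define k where "k n = Max (?G n)" for n
  have fin: "finite (?G n)" for n
    by (rule finite_subset[of _ "{..n}"]) auto
  have k: "k n \<in> ?G n" for n
    unfolding k_def by (rule Max_in[OF fin]) auto
  have top: "filterlim k at_top sequentially"
    unfolding filterlim_at_top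
  proof
    fix K
    have "\<forall>\<^sub>F n in sequentially. e K n < 1 / Suc K"
      using lim[of K] by (rule order_tendstoD) simp
    then obtain N where N: "\<And>n. N \<le> n \<Longrightarrow> e K n < 1 / Suc K"
      by (auto simp: eventually_sequentially)
    show "\<forall>\<^sub>F n in sequentially. K \<le> k n"
    proof (rule eventually_mono[OF eventually_ge_at_top[of "max N K"]])
      fix n assume n: "max N K \<le> n"
      then have "K \<in> ?G n"
        using N by (force intro: less_imp_le)
      then show "K \<le> k n"
        unfolding k_def by (rule Max_ge[OF fin])
    qed
  qed
  have "(\<lambda>n. e (k n) n) \<longlonglongrightarrow> 0"
  proof (rule tendsto_sandwich[OF _ _ tendsto_const])
    show "\<forall>\<^sub>F n in sequentially. e (k n) n \<le> 1 / Suc (k n)"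
      using filterlim_at_top[THEN iffD1, OF top, THEN spec, of 1]
    proof (rule eventually_mono)
      fix n assume "1 \<le> k n"
      then show "e (k n) n \<le> 1 / Suc (k n)"
        using k[of n] by auto
    qed
    have "(\<lambda>n. 1 / real (Suc n)) \<longlonglongrightarrow> 0"
      by real_asymp
    then show "(\<lambda>n. 1 / real (Suc (k n))) \<longlonglongrightarrow> 0"
      by (rule filterlim_compose) (rule top)
  qed (simp add: nonneg)
  with top show ?thesis
    by (rule that)
qed

text \<open>Below the bound the codes have rate exactly \<open>R\<close>; at the bound, codes for
  rates increasing to \<open>R\<close> are combined along a diagonal.\<close>

theorem corollary1:
  fixes Q :: "'x::finite \<Rightarrow> ('y::finite \<times> 'z::finite) pmf"
    and C12 C21 R :: real
  assumes "0 \<le> C12" and "0 \<le> C21" and "0 \<le> R"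
    and "ereal R \<le> rate_bound Q C12 C21"
  shows "achievable Q C12 C21 R \<and>
         (ereal R < rate_bound Q C12 C21 \<longrightarrow> achievable_exactly Q C12 C21 R)"
proof
  have rates: "achievable_rates Q C12 C21 r"
    if "\<And>n. is_code n (r n) C12 C21 (c n)" "(\<lambda>n. error_prob Q n (r n) (c n)) \<longlonglongrightarrow> 0"
    for r and c :: "nat \<Rightarrow> ('x, 'y, 'z) bc_code"
    unfolding achievable_rates_def using that assms(1,2)
    by (intro bexI[of _ C12] bexI[of _ C21] exI[of _ c]) auto
  show "achievable Q C12 C21 R"
  proof (cases "R = 0")
    case True
    \<comment> \<open>No nonnegative rate lies strictly below 0, so this case needs its own code:
      the only message is 1, and constant decoders never err.\<close>
    define c :: "('x, 'y, 'z) bc_code" where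
      "c = \<lparr>encoder = undefined, conf = First1 (\<lambda>_. 1) (\<lambda>_ _. 1), decoder1 = \<lambda>_ _. 1, decoder2 = \<lambda>_ _. 1\<rparr>"
    have "is_code n 0 C12 C21 c" for n
      using message_set_bounds(1)[OF assms(1), of n] message_set_bounds(1)[OF assms(2), of n]
      by (auto simp: is_code_def c_def message_set_def)
    moreover have "error_prob Q n 0 c = 0" for n
      by (auto simp: error_prob_eq_block_error block_error_def message_set_def decoding_error_def c_def)
    ultimately have "achievable_rates Q C12 C21 (\<lambda>_. 0)"
      by (intro rates[of _ "\<lambda>_. c"]) simp_all
    then show ?thesis
      unfolding achievable_def using True by (intro exI[of _ "\<lambda>_. 0"]) simp
  next
    case False
    \<comment> \<open>The offset 2 makes the factor lie between 1/2 and 1, so the rates are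
      nonnegative and strictly below \<open>R\<close> from \<open>k = 0\<close> on.\<close>
    define r where "r k = R * (1 - 1 / real (k + 2))" for k :: nat
    have r: "0 \<le> r k" "r k < R" for k
      using assms(3) False by (auto simp: r_def field_simps)
    have "ereal (r k) < rate_bound Q C12 C21" for k
      using r(2)[of k] assms(4) by (meson ereal_less_eq(3) less_ereal.simps(1) less_le_trans)
    then have "\<exists>c :: nat \<Rightarrow> ('x, 'y, 'z) bc_code. (\<forall>n. is_code n (r k) C12 C21 (c n)) \<and>
        (\<lambda>n. error_prob Q n (r k) (c n)) \<longlonglongrightarrow> 0" for k
      using assms(1,2) r(1) by (intro codes_below_rate_bound)
    then obtain c :: "nat \<Rightarrow> nat \<Rightarrow> ('x, 'y, 'z) bc_code" where
      c: "\<And>k n. is_code n (r k) C12 C21 (c k n)" "\<And>k. (\<lambda>n. error_prob Q n (r k) (c k n)) \<longlonglongrightarrow> 0"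
      by metis
    obtain k :: "nat \<Rightarrow> nat" where k: "filterlim k at_top sequentially"
      "(\<lambda>n. error_prob Q n (r (k n)) (c (k n) n)) \<longlonglongrightarrow> 0"
      by (rule tendsto_diagonal[where e = "\<lambda>k n. error_prob Q n (r k) (c k n)"])
        (use c in \<open>auto simp: error_prob_def\<close>)
    have "r \<longlonglongrightarrow> R"
      unfolding r_def by real_asymp
    then have "(\<lambda>n. r (k n)) \<longlonglongrightarrow> R"
      using k(1) by (rule filterlim_compose)
    moreover have "achievable_rates Q C12 C21 (\<lambda>n. r (k n))"
      using c(1) k(2) by (intro rates[of _ "\<lambda>n. c (k n) n"])
    ultimately show ?thesis
      unfolding achievable_def using r(1) by (intro exI[of _ "\<lambda>n. r (k n)"]) auto
  qed
  show "ereal R < rate_bound Q C12 C21 \<longrightarrow> achievable_exactly Q C12 C21 R"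
    unfolding achievable_exactly_def
    using codes_below_rate_bound[OF assms(1-3)] rates[of "\<lambda>_. R"] by blast
qed

end
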